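(* Let $s\in\mathbb{N}$ and let $H$ be an $s$-periodic generalized Jacobi operator. Let $w_1(\lambda),w_2(\lambda)$ be the roots of the characteristic equation $\det(T(\lambda)-w)=0$ of the monodromy matrix $T(\lambda)$, and set $$E=\{\lambda\in\mathbb{C}: |w_1(\lambda)|=|w_2(\lambda)|\},$$ $$E_p=\{\lambda\in\mathbb{C}: P_{s-1}(\lambda)=0,\ |b_{s-1}Q_{s-1}(\lambda)|>|P_s(\lambda)|\}.$$ Then the spectrum and the point spectrum (set of eigenvalues) of $H$ are $$\sigma(H)=E\cup E_p,\qquad \sigma_p(H)=E_p.$$
   Context: $\mathbb{Z}_+=\{0,1,2,\dots\}$; $\ell^2_{[0,\infty)}$ is the Hilbert space of complex square summable sequences $(w_0,w_1,\dots)$. Data: for $j\in\mathbb{Z}_+$ let $p_j(\lambda)=\lambda^{k_j}+p^{(j)}_{k_j-1}\lambda^{k_j-1}+\dots+p^{(j)}_1\lambda+p^{(j)}_0$ be a real monic polynomial of degree $k_j\ge 1$, $\varepsilon_j\in\{1,-1\}$, $b_j>0$. For a monic polynomial $p(\lambda)=\lambda^n+p_{n-1}\lambda^{n-1}+\dots+p_0$ the companion matrix $C_p$ is the $n\times n$ matrix with ones on the first subdiagonal, last column $(-p_0,-p_1,\dots,-p_{n-1})^\top$, and zeros elsewhere. The generalized Jacobi matrix associated with $\{\varepsilon_jp_j\}$ and $\{b_j\}$ is the infinite tridiagonal block matrix $H$ with diagonal blocks $A_j=C_{p_j}$ ($k_j\times k_j$), subdiagonal blocks $B_j$ in block position $(j+1,j)$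 ($k_{j+1}\times k_j$), and superdiagonal blocks $\widetilde B_j$ in block position $(j,j+1)$ ($k_j\times k_{j+1}$); the only nonzero entry of $B_j$ is its upper right corner entry, equal to $b_j$, and the only nonzero entry of $\widetilde B_j$ is its upper right corner entry, equal to $\varepsilon_j\varepsilon_{j+1}b_j$. $H$ is called $s$-periodic if $A_{js+k}=A_k$, $B_{js+k}=B_k$, $\varepsilon_{js+k}=\varepsilon_k$ for all $j\in\mathbb{Z}_+$, $k\in\{0,\dots,s-1\}$; the bounded operator it generates in $\ell^2_{[0,\infty)}$ is the $s$-periodic generalized Jacobi operator, also denoted $H$; spectra are those of this operator. The polynomials $P_j,Q_j$ are the solutions of $$\varepsilon_{j-1}\varepsilon_jb_{j-1}u_{j-1}-p_j(\lambda)u_j+b_ju_{j+1}=0\quad(j\ge 1)$$ with initial conditions $P_0=1$, $P_1=p_0(\lambda)/b_0$, $Q_0=0$, $Q_1=\varepsilon_0/b_0$. The monodromy matrix is $$T(\lambda)=\begin{pmatrix}-\varepsilon_{s-1}b_{s-1}Q_{s-1}(\lambda)&-Q_s(\lambda)\\ \varepsilon_{s-1}b_{s-1}P_{s-1}(\lambda)&P_s(\lambda)\end{pmatrix},$$ which equals the product $\mathcal{W}_0(\lambda)\mathcal{W}_1(\lambda)\cdots\mathcal{W}_{s-1}(\lambda)$ with $\mathcal{W}_j(\lambda)=\begin{pmatrix}0&-\varepsilon_j/b_j\\ \varepsilon_jb_j&p_j(\lambda)/b_j\end{pmatrix}$; here $w_1(\lambda),w_2(\lambda)$ are counted with multiplicity.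 *)

theory Defs
  imports Complex_Main "HOL-Computational_Algebra.Polynomial" "Jordan_Normal_Form.Char_Poly"
begin

text \<open>The Hilbert space of square summable sequences, as a set of sequences.\<close>

definition ell2 :: "(nat \<Rightarrow> complex) set" where
  "ell2 = {w. summable (\<lambda>n. (cmod (w n))\<^sup>2)}"

definition ell2_norm :: "(nat \<Rightarrow> complex) \<Rightarrow> real" where
  "ell2_norm w = sqrt (\<Sum>n. (cmod (w n))\<^sup>2)"

text \<open>For an operator on \<open>ell2\<close>, given by a map on sequences: a point is in the resolvent
  set iff \<open>F - z I\<close> is a bijection of \<open>ell2\<close> whose inverse is bounded.\<close>

definition ell2_resolvent_set :: "((nat \<Rightarrow> complex) \<Rightarrow> nat \<Rightarrow> complex) \<Rightarrow> complex set" where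
  "ell2_resolvent_set F =
     {z. bij_betw (\<lambda>w n. F w n - z * w n) ell2 ell2 \<and>
         (\<exists>K. \<forall>w\<in>ell2. ell2_norm w \<le> K * ell2_norm (\<lambda>n. F w n - z * w n))}"

definition ell2_spectrum :: "((nat \<Rightarrow> complex) \<Rightarrow> nat \<Rightarrow> complex) \<Rightarrow> complex set" where
  "ell2_spectrum F = - ell2_resolvent_set F"

definition ell2_point_spectrum :: "((nat \<Rightarrow> complex) \<Rightarrow> nat \<Rightarrow> complex) \<Rightarrow> complex set" where
  "ell2_point_spectrum F =
     {z. \<exists>w\<in>ell2. w \<noteq> (\<lambda>_. 0) \<and> F w = (\<lambda>n. z * w n)}"

definition companion_mat :: "real poly \<Rightarrow> real mat" where
  "companion_mat p = mat (degree p) (degree p)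
     (\<lambda>(i, j). if j = degree p - 1 then - coeff p i else if i = Suc j then 1 else 0)"

definition upper_right_mat :: "nat \<Rightarrow> nat \<Rightarrow> real \<Rightarrow> real mat" where
  "upper_right_mat r c x = mat r c (\<lambda>(i, j). if i = 0 \<and> j = c - 1 then x else 0)"

definition diag_block :: "(nat \<Rightarrow> real poly) \<Rightarrow> nat \<Rightarrow> real mat" where
  "diag_block p j = companion_mat (p j)"

definition sub_block :: "(nat \<Rightarrow> real poly) \<Rightarrow> (nat \<Rightarrow> real) \<Rightarrow> nat \<Rightarrow> real mat" where
  "sub_block p b j = upper_right_mat (degree (p (Suc j))) (degree (p j)) (b j)"

definition super_block ::
  "(nat \<Rightarrow> real poly) \<Rightarrow> (nat \<Rightarrow> real) \<Rightarrow> (nat \<Rightarrow> real) \<Rightarrow> nat \<Rightarrow> real mat" where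
  "super_block p \<epsilon> b j =
     upper_right_mat (degree (p j)) (degree (p (Suc j))) (\<epsilon> j * \<epsilon> (Suc j) * b j)"

definition gjm_block ::
  "(nat \<Rightarrow> real poly) \<Rightarrow> (nat \<Rightarrow> real) \<Rightarrow> (nat \<Rightarrow> real) \<Rightarrow> nat \<Rightarrow> nat \<Rightarrow> real mat" where
  "gjm_block p \<epsilon> b i j =
     (if i = j then diag_block p j
      else if i = Suc j then sub_block p b j
      else if j = Suc i then super_block p \<epsilon> b i
      else 0\<^sub>m (degree (p i)) (degree (p j)))"

text \<open>Flattening of a block matrix with block sizes \<open>k 0, k 1, \<dots>\<close>: the scalar index \<open>m\<close> is
  position \<open>block_pos k m\<close> inside block \<open>block_index k m\<close>.\<close>

definition block_offset :: "(nat \<Rightarrow> nat) \<Rightarrow> nat \<Rightarrow> nat" where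
  "block_offset k j = (\<Sum>i<j. k i)"

definition block_index :: "(nat \<Rightarrow> nat) \<Rightarrow> nat \<Rightarrow> nat" where
  "block_index k m = (LEAST j. m < block_offset k (Suc j))"

definition block_pos :: "(nat \<Rightarrow> nat) \<Rightarrow> nat \<Rightarrow> nat" where
  "block_pos k m = m - block_offset k (block_index k m)"

lemma block_index_offset:
  assumes "a < k j"
  shows "block_index k (block_offset k j + a) = j"
  unfolding block_index_def
proof (rule Least_equality)
  show "block_offset k j + a < block_offset k (Suc j)"
    using assms by (simp add: block_offset_def)
next
  fix i assume i: "block_offset k j + a < block_offset k (Suc i)"
  show "j \<le> i"
  proof (rule ccontr)
    assume "\<not> j \<le> i"
    hence "block_offset k (Suc i) \<le> block_offset k j"
      unfolding block_offset_def by (intro sum_mono2) auto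
    with i show False by simp
  qed
qed

lemma block_pos_offset: "a < k j \<Longrightarrow> block_pos k (block_offset k j + a) = a"
  by (simp add: block_pos_def block_index_offset)

definition gjm_entry ::
  "(nat \<Rightarrow> real poly) \<Rightarrow> (nat \<Rightarrow> real) \<Rightarrow> (nat \<Rightarrow> real) \<Rightarrow> nat \<Rightarrow> nat \<Rightarrow> real" where
  "gjm_entry p \<epsilon> b m n =
     (let k = (\<lambda>j. degree (p j))
      in gjm_block p \<epsilon> b (block_index k m) (block_index k n) $$ (block_pos k m, block_pos k n))"

text \<open>The matrix acting on sequences; each row has finitely many nonzero entries, so the series
  is a finite sum.\<close>

definition gj_operator ::
  "(nat \<Rightarrow> real poly) \<Rightarrow> (nat \<Rightarrow> real) \<Rightarrow> (nat \<Rightarrow> real) \<Rightarrow> (nat \<Rightarrow> complex) \<Rightarrow> nat \<Rightarrow> complex" where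
  "gj_operator p \<epsilon> b w = (\<lambda>m. \<Sum>n. complex_of_real (gjm_entry p \<epsilon> b m n) * w n)"

definition gj_data ::
  "(nat \<Rightarrow> real poly) \<Rightarrow> (nat \<Rightarrow> real) \<Rightarrow> (nat \<Rightarrow> real) \<Rightarrow> bool" where
  "gj_data p \<epsilon> b \<longleftrightarrow>
     (\<forall>j. lead_coeff (p j) = 1 \<and> degree (p j) \<ge> 1 \<and> \<epsilon> j \<in> {1, -1} \<and> b j > 0)"

definition gj_periodic ::
  "nat \<Rightarrow> (nat \<Rightarrow> real poly) \<Rightarrow> (nat \<Rightarrow> real) \<Rightarrow> (nat \<Rightarrow> real) \<Rightarrow> bool" where
  "gj_periodic s p \<epsilon> b \<longleftrightarrow>
     (\<forall>j. \<forall>k<s. diag_block p (j * s + k) = diag_block p k \<and>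
                sub_block p b (j * s + k) = sub_block p b k \<and>
                \<epsilon> (j * s + k) = \<epsilon> k)"

fun gj_solution ::
  "(nat \<Rightarrow> real poly) \<Rightarrow> (nat \<Rightarrow> real) \<Rightarrow> (nat \<Rightarrow> real) \<Rightarrow> real poly \<Rightarrow> real poly \<Rightarrow> nat \<Rightarrow> real poly" where
  "gj_solution p \<epsilon> b u0 u1 0 = u0"
| "gj_solution p \<epsilon> b u0 u1 (Suc 0) = u1"
| "gj_solution p \<epsilon> b u0 u1 (Suc (Suc j)) =
     Polynomial.smult (1 / b (Suc j))
       (p (Suc j) * gj_solution p \<epsilon> b u0 u1 (Suc j)
        - Polynomial.smult (\<epsilon> j * \<epsilon> (Suc j) * b j) (gj_solution p \<epsilon> b u0 u1 j))"

lemma gj_solution_recurrence: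
  assumes "gj_data p \<epsilon> b" and "j \<ge> 1"
  shows "Polynomial.smult (\<epsilon> (j - 1) * \<epsilon> j * b (j - 1)) (gj_solution p \<epsilon> b u0 u1 (j - 1))
         - p j * gj_solution p \<epsilon> b u0 u1 j + Polynomial.smult (b j) (gj_solution p \<epsilon> b u0 u1 (j + 1)) = 0"
proof -
  obtain i where j: "j = Suc i" using assms(2) by (cases j) auto
  have "b (Suc i) \<noteq> 0" using assms(1) unfolding gj_data_def by (metis less_irrefl)
  thus ?thesis by (simp add: j)
qed

text \<open>The polynomials of the first and second kind, evaluated at complex points.\<close>

definition gj_P ::
  "(nat \<Rightarrow> real poly) \<Rightarrow> (nat \<Rightarrow> real) \<Rightarrow> (nat \<Rightarrow> real) \<Rightarrow> nat \<Rightarrow> complex \<Rightarrow> complex" where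
  "gj_P p \<epsilon> b j z =
     poly (map_poly complex_of_real (gj_solution p \<epsilon> b 1 (Polynomial.smult (1 / b 0) (p 0)) j)) z"

definition gj_Q ::
  "(nat \<Rightarrow> real poly) \<Rightarrow> (nat \<Rightarrow> real) \<Rightarrow> (nat \<Rightarrow> real) \<Rightarrow> nat \<Rightarrow> complex \<Rightarrow> complex" where
  "gj_Q p \<epsilon> b j z =
     poly (map_poly complex_of_real (gj_solution p \<epsilon> b 0 [:\<epsilon> 0 / b 0:] j)) z"

definition monodromy_mat ::
  "nat \<Rightarrow> (nat \<Rightarrow> real poly) \<Rightarrow> (nat \<Rightarrow> real) \<Rightarrow> (nat \<Rightarrow> real) \<Rightarrow> complex \<Rightarrow> complex mat" where
  "monodromy_mat s p \<epsilon> b z =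
     (let c = complex_of_real (\<epsilon> (s - 1) * b (s - 1))
      in mat_of_rows_list 2
           [[- c * gj_Q p \<epsilon> b (s - 1) z, - gj_Q p \<epsilon> b s z],
            [c * gj_P p \<epsilon> b (s - 1) z, gj_P p \<epsilon> b s z]])"

end

theory Submission
  imports Defs "HOL-Analysis.Convex"
begin

text \<open>Inside a block the equation \<open>(H - z) w = f\<close> is a recursion that expresses all entries
  through the last one. Eliminating them leaves the three-term recurrence of the polynomials
  \<open>P\<^sub>j, Q\<^sub>j\<close> for the last entries (up to the signs \<open>\<epsilon>\<^sub>j\<close>), with a square summable right-hand
  side, and since block sizes and coefficients are bounded, everything reduces to this recurrence.

  The monodromy matrix has determinant 1. If both of its eigenvalues have modulus 1, the recurrence
  has no nonzero square summable solution at all, so the first unit vector is not in the range of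
  \<open>H - z\<close>. If \<open>|w\<^sub>1| < 1 < |w\<^sub>2|\<close>, the square summable solutions are those starting in the
  \<open>w\<^sub>1\<close>-eigenvector; the boundary condition at 0 admits one exactly when \<open>(0, 1)\<close> is a
  \<open>w\<^sub>1\<close>-eigenvector, which is the condition defining \<open>E\<^sub>p\<close>. Otherwise the inhomogeneous recurrence
  is solved with a bound by variation of constants in a Floquet basis.\<close>

section \<open>Square summable sequences\<close>

text \<open>Multiplying the last entry of block \<open>j\<close> by \<open>\<epsilon> j\<close>
  makes the recurrence symmetric: the same number \<open>\<epsilon> n * b n\<close> couples
  \<open>n\<close> to \<open>n + 1\<close> and back. This symmetry preserves the Wronskian, so the
  two roots are reciprocal and \<open>E\<close> is the set where both have modulus 1. On
  \<open>E\<close> the monodromy matrix may fail to be diagonalizable, so decaying solutions are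
  studied with the Cayley-Hamilton identity and not with a basis of eigenvectors; such a basis is
  built only off \<open>E\<close>, where the roots are distinct. A resolvent point needs a bounded
  inverse, so the solution is constructed together with explicit constants, and periodicity makes
  them uniform over the blocks.\<close>

lemma square_convex_le:
  fixes \<rho> u v :: real
  assumes "0 \<le> \<rho>" "\<rho> < 1"
  shows "(\<rho> * u + v)\<^sup>2 \<le> \<rho> * u\<^sup>2 + v\<^sup>2 / (1 - \<rho>)"
proof -
  \<comment> \<open>This is convexity of the square for the mean of \<open>u\<close> and
    \<open>v / (1 - \<rho>)\<close> with weights \<open>\<rho>\<close> and
    \<open>1 - \<rho>\<close>. In this form a contraction of norms keeps its factor when passing to
    squares.\<close>
  have "\<rho> * u\<^sup>2 + v\<^sup>2 / (1 - \<rho>) - (\<rho> * u + v)\<^sup>2 = \<rho> / (1 - \<rho>) * ((1 - \<rho>) * u - v)\<^sup>2"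
    using assms by (simp add: field_simps power2_eq_square)
  also have "\<dots> \<ge> 0"
    using assms by simp
  finally show ?thesis by simp
qed

text \<open>After summation the term with \<open>\<theta>\<close> is at most \<open>\<theta>\<close>
  times the same partial sum and moves to the left side. A step of length \<open>s\<close> leaves
  the first \<open>s\<close> terms free: \<open>s = 1\<close> serves scalar recursions, the period
  serves decaying orbits.\<close>

lemma contraction_forward:
  fixes A F :: "nat \<Rightarrow> real"
  assumes A: "\<And>n. 0 \<le> A n" and F: "\<And>n. 0 \<le> F n" "summable F"
    and \<theta>: "0 \<le> \<theta>" "\<theta> < 1"
    and step: "\<And>n. A (n + s) \<le> \<theta> * A n + F n"
  shows "summable A" "suminf A \<le> (sum A {..<s} + suminf F) / (1 - \<theta>)"
proof -
  have bound: "sum A {..<N} \<le> (sum A {..<s} + suminf F) / (1 - \<theta>)" for N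
  proof -
    have "sum A {..<N} \<le> sum A {..<N + s}"
      by (rule sum_mono2) (auto simp: A)
    also have "\<dots> = sum A {..<s} + (\<Sum>n<N. A (n + s))"
      by (induction N) auto
    also have "\<dots> \<le> sum A {..<s} + (\<Sum>n<N. \<theta> * A n + F n)"
      by (intro add_left_mono sum_mono step)
    also have "\<dots> = sum A {..<s} + \<theta> * sum A {..<N} + sum F {..<N}"
      by (simp add: sum.distrib sum_distrib_left)
    also have "\<dots> \<le> sum A {..<s} + \<theta> * sum A {..<N} + suminf F"
      using sum_le_suminf[OF F(2), of "{..<N}"] F(1) by auto
    finally show ?thesis
      using \<theta> by (simp add: field_simps)
  qed
  show "summable A"
    by (rule summableI_nonneg_bounded[OF A bound])
  thus "suminf A \<le> (sum A {..<s} + suminf F) / (1 - \<theta>)"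
    by (rule suminf_le_const) (rule bound)
qed

text \<open>Here a term is bounded by its successor, so a partial sum produces a boundary term at
  its far end, which \<open>B\<close> controls. The final estimate is free of \<open>B\<close>
  because the step is summed once more over the whole series.\<close>

lemma contraction_backward:
  fixes A F :: "nat \<Rightarrow> real"
  assumes A: "\<And>n. 0 \<le> A n" "\<And>n. A n \<le> B" and F: "\<And>n. 0 \<le> F n" "summable F"
    and \<theta>: "0 \<le> \<theta>" "\<theta> < 1"
    and step: "\<And>n. A n \<le> \<theta> * A (Suc n) + F n"
  shows "summable A" "suminf A \<le> suminf F / (1 - \<theta>)"
proof -
  have shift: "(\<Sum>n<N. A (Suc n)) = sum A {..<N} + A N - A 0" for N
    by (induction N) auto
  have bound: "sum A {..<N} \<le> (\<theta> * B + suminf F) / (1 - \<theta>)" for N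
  proof -
    have "sum A {..<N} \<le> (\<Sum>n<N. \<theta> * A (Suc n) + F n)"
      by (intro sum_mono step)
    also have "\<dots> = \<theta> * (sum A {..<N} + A N - A 0) + sum F {..<N}"
      by (simp add: sum.distrib sum_distrib_left flip: shift)
    also have "\<dots> \<le> \<theta> * (sum A {..<N} + B) + suminf F"
      using sum_le_suminf[OF F(2), of "{..<N}"] F(1) A(1)[of 0] A(2)[of N] \<theta>
      by (intro add_mono mult_left_mono) auto
    finally show ?thesis
      using \<theta> by (simp add: field_simps)
  qed
  show sA: "summable A"
    by (rule summableI_nonneg_bounded[OF A(1) bound])
  have "suminf A \<le> (\<Sum>n. \<theta> * A (Suc n) + F n)"
    using sA F by (intro suminf_le step summable_add summable_mult) (simp_all add: summable_Suc_iff)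
  also have "\<dots> = \<theta> * (suminf A - A 0) + suminf F"
    using sA F by (subst suminf_add[symmetric])
      (auto simp: suminf_mult suminf_split_head summable_Suc_iff)
  also have "\<dots> \<le> \<theta> * suminf A + suminf F"
    using \<theta> A(1)[of 0] by (simp add: algebra_simps)
  finally show "suminf A \<le> suminf F / (1 - \<theta>)"
    using \<theta> by (simp add: field_simps)
qed

lemma square_sum_le:
  fixes u v :: "nat \<Rightarrow> real" and w :: "nat \<Rightarrow> real"
  assumes u: "summable (\<lambda>n. (u n)\<^sup>2)" and v: "summable (\<lambda>n. (v n)\<^sup>2)"
    and w: "\<And>n. \<bar>w n\<bar> \<le> M * (\<bar>u n\<bar> + \<bar>v n\<bar>)"
  shows "summable (\<lambda>n. (w n)\<^sup>2)"
    "(\<Sum>n. (w n)\<^sup>2) \<le> 2 * M\<^sup>2 * ((\<Sum>n. (u n)\<^sup>2) + (\<Sum>n. (v n)\<^sup>2))"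
proof -
  have le: "(w n)\<^sup>2 \<le> 2 * M\<^sup>2 * ((u n)\<^sup>2 + (v n)\<^sup>2)" for n
  proof -
    have "\<bar>w n\<bar>\<^sup>2 \<le> (M * (\<bar>u n\<bar> + \<bar>v n\<bar>))\<^sup>2"
      by (rule power_mono[OF w]) simp
    also have "\<dots> = M\<^sup>2 * (\<bar>u n\<bar> + \<bar>v n\<bar>)\<^sup>2"
      by (simp add: power_mult_distrib)
    also have "\<dots> \<le> M\<^sup>2 * (2 * ((u n)\<^sup>2 + (v n)\<^sup>2))"
      using sum_squares_bound[of "\<bar>u n\<bar>" "\<bar>v n\<bar>"]
      by (intro mult_left_mono) (auto simp: power2_sum)
    finally show ?thesis by (simp add: algebra_simps)
  qed
  have sr: "summable (\<lambda>n. 2 * M\<^sup>2 * ((u n)\<^sup>2 + (v n)\<^sup>2))"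
    by (intro summable_mult summable_add u v)
  show sw: "summable (\<lambda>n. (w n)\<^sup>2)"
    by (rule summable_comparison_test'[OF sr, of 0]) (simp add: le)
  have "(\<Sum>n. (w n)\<^sup>2) \<le> (\<Sum>n. 2 * M\<^sup>2 * ((u n)\<^sup>2 + (v n)\<^sup>2))"
    by (rule suminf_le[OF le sw sr])
  also have "\<dots> = 2 * M\<^sup>2 * ((\<Sum>n. (u n)\<^sup>2) + (\<Sum>n. (v n)\<^sup>2))"
    by (simp add: suminf_mult summable_add u v suminf_add)
  finally show "(\<Sum>n. (w n)\<^sup>2) \<le> 2 * M\<^sup>2 * ((\<Sum>n. (u n)\<^sup>2) + (\<Sum>n. (v n)\<^sup>2))" .
qed

lemma ell2_tendsto_0:
  assumes "u \<in> ell2"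
  shows "u \<longlonglongrightarrow> 0"
proof -
  have "(\<lambda>n. (cmod (u n))\<^sup>2) \<longlonglongrightarrow> 0"
    using assms by (intro summable_LIMSEQ_zero) (simp add: ell2_def)
  hence "(\<lambda>n. sqrt ((cmod (u n))\<^sup>2)) \<longlonglongrightarrow> sqrt 0"
    by (rule tendsto_real_sqrt)
  thus ?thesis
    by (simp add: tendsto_norm_zero_iff)
qed

abbreviation sqsum :: "(nat \<Rightarrow> complex) \<Rightarrow> real" where
  "sqsum u \<equiv> \<Sum>n. (cmod (u n))\<^sup>2"

lemma ell2_sum_le:
  assumes "u \<in> ell2"
  shows "(\<Sum>n<N. (cmod (u n))\<^sup>2) \<le> sqsum u"
  using assms by (intro sum_le_suminf) (auto simp: ell2_def)

lemma ell2_le_sqsum: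
  assumes "u \<in> ell2"
  shows "(cmod (u n))\<^sup>2 \<le> sqsum u"
  using ell2_sum_le[OF assms, of "Suc n"]
    sum_nonneg[of "{..<n}" "\<lambda>m. (cmod (u m))\<^sup>2"] by simp

lemma sqsum_nonneg: "u \<in> ell2 \<Longrightarrow> 0 \<le> sqsum u"
  using ell2_sum_le[of u 0] by simp

lemma ell2_bounded_mult:
  assumes "g \<in> ell2" "\<And>n. cmod (c n) \<le> M"
  shows "(\<lambda>n. c n * g n) \<in> ell2" "sqsum (\<lambda>n. c n * g n) \<le> M\<^sup>2 * sqsum g"
proof -
  have le: "(cmod (c n * g n))\<^sup>2 \<le> M\<^sup>2 * (cmod (g n))\<^sup>2" for n
    by (simp add: norm_mult power_mult_distrib mult_right_mono power_mono assms(2))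
  have sr: "summable (\<lambda>n. M\<^sup>2 * (cmod (g n))\<^sup>2)"
    using assms(1) by (intro summable_mult) (simp add: ell2_def)
  have sl: "summable (\<lambda>n. (cmod (c n * g n))\<^sup>2)"
    by (rule summable_comparison_test'[OF sr, of 0]) (use le in simp)
  show "(\<lambda>n. c n * g n) \<in> ell2"
    using sl by (simp add: ell2_def)
  show "sqsum (\<lambda>n. c n * g n) \<le> M\<^sup>2 * sqsum g"
    using suminf_le[OF le sl sr] assms(1) by (simp add: suminf_mult ell2_def)
qed

lemma ell2_stable_recursion:
  assumes "cmod \<mu> < 1" "h \<in> ell2" and step: "\<And>n. \<alpha> (Suc n) = \<mu> * \<alpha> n + h n"
  shows "\<alpha> \<in> ell2"
    "sqsum \<alpha> \<le> ((cmod (\<alpha> 0))\<^sup>2 + sqsum h / (1 - cmod \<mu>)) / (1 - cmod \<mu>)"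
proof -
  have le: "(cmod (\<alpha> (n + 1)))\<^sup>2 \<le> cmod \<mu> * (cmod (\<alpha> n))\<^sup>2 + (cmod (h n))\<^sup>2 / (1 - cmod \<mu>)" for n
  proof -
    have "(cmod (\<alpha> (n + 1)))\<^sup>2 \<le> (cmod \<mu> * cmod (\<alpha> n) + cmod (h n))\<^sup>2"
      using norm_triangle_ineq[of "\<mu> * \<alpha> n" "h n"] by (intro power_mono) (auto simp: step norm_mult)
    also have "\<dots> \<le> cmod \<mu> * (cmod (\<alpha> n))\<^sup>2 + (cmod (h n))\<^sup>2 / (1 - cmod \<mu>)"
      using assms(1) by (intro square_convex_le) simp_all
    finally show ?thesis .
  qed
  have "summable (\<lambda>n. (cmod (h n))\<^sup>2 / (1 - cmod \<mu>))"
    using assms(2) by (intro summable_divide) (simp add: ell2_def)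
  from contraction_forward[OF _ _ this _ _ le] assms
  show "\<alpha> \<in> ell2" "sqsum \<alpha> \<le> ((cmod (\<alpha> 0))\<^sup>2 + sqsum h / (1 - cmod \<mu>)) / (1 - cmod \<mu>)"
    by (auto simp: ell2_def suminf_divide)
qed

text \<open>Forward iteration amplifies the initial value by \<open>inverse \<mu>\<close>, so the
  solution is prescribed from infinity and its initial value depends on all of
  \<open>h\<close>.\<close>

lemma ell2_unstable_recursion:
  assumes "\<mu> \<noteq> 0" "cmod \<mu> < 1" "h \<in> ell2"
  obtains \<beta> where "\<And>n. \<beta> (Suc n) = inverse \<mu> * \<beta> n + h n" "\<beta> \<in> ell2"
    "sqsum \<beta> \<le> sqsum h / (1 - cmod \<mu>)\<^sup>2"
proof -
  define B where "B = sqrt (sqsum h)"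
  have h: "cmod (h n) \<le> B" for n
    unfolding B_def using ell2_le_sqsum[OF assms(3), of n] by (intro real_le_rsqrt)
  have B: "B \<ge> 0"
    using h[of 0] norm_ge_zero order_trans by blast
  \<comment> \<open>The limit of iterating
    \<open>\<beta> n = \<mu> * (\<beta> (Suc n) - h n)\<close>, with the remainder
    \<open>\<mu> ^ k * \<beta> (n + k)\<close> dropped.\<close>
  define \<beta> where "\<beta> n = - (\<Sum>k. \<mu> ^ Suc k * h (n + k))" for n
  have le: "cmod (\<mu> ^ Suc k * h (n + k)) \<le> B * cmod \<mu> ^ k" for n k
  proof -
    have "cmod \<mu> ^ Suc k * cmod (h (n + k)) \<le> cmod \<mu> ^ k * B"
      using assms(2) by (intro mult_mono h) (auto simp: mult_left_le_one_le)
    thus ?thesis by (simp add: norm_mult norm_power mult.commute)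
  qed
  have geo: "summable (\<lambda>k. B * cmod \<mu> ^ k)"
    using assms(2) by (intro summable_mult summable_geometric) simp
  have sn: "summable (\<lambda>k. cmod (\<mu> ^ Suc k * h (n + k)))" for n
    by (rule summable_comparison_test'[OF geo, of 0]) (use le in simp)
  have s: "summable (\<lambda>k. \<mu> ^ Suc k * h (n + k))" for n
    by (rule summable_norm_cancel[OF sn])
  have bound: "cmod (\<beta> n) \<le> (\<Sum>k. B * cmod \<mu> ^ k)" for n
    unfolding \<beta>_def norm_minus_cancel
    by (rule order_trans[OF summable_norm[OF sn] suminf_le[OF le sn geo]])
  have rec: "\<beta> n = \<mu> * (\<beta> (Suc n) - h n)" for n
  proof -
    have "\<beta> n = - (\<mu> * h n) - (\<Sum>k. \<mu> ^ Suc (Suc k) * h (n + Suc k))"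
      unfolding \<beta>_def using suminf_split_head[OF s[of n]] by simp
    also have "(\<Sum>k. \<mu> ^ Suc (Suc k) * h (n + Suc k)) = (\<Sum>k. \<mu> * (\<mu> ^ Suc k * h (Suc n + k)))"
      by (simp add: mult.assoc)
    also have "\<dots> = - \<mu> * \<beta> (Suc n)"
      unfolding \<beta>_def by (subst suminf_mult[OF s]) simp
    finally show ?thesis by (simp add: algebra_simps)
  qed
  have conv: "(cmod (\<beta> n))\<^sup>2 \<le> cmod \<mu> * (cmod (\<beta> (Suc n)))\<^sup>2 + (cmod (h n))\<^sup>2 / (1 - cmod \<mu>)" for n
  proof -
    have "cmod (\<beta> n) = cmod \<mu> * cmod (\<beta> (Suc n) - h n)"
      by (subst rec) (simp add: norm_mult)
    also have "\<dots> \<le> cmod \<mu> * (cmod (\<beta> (Suc n)) + cmod (h n))"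
      by (intro mult_left_mono norm_triangle_ineq4) simp
    also have "\<dots> \<le> cmod \<mu> * cmod (\<beta> (Suc n)) + cmod (h n)"
      using assms(2) by (simp add: distrib_left mult_left_le_one_le)
    finally have "(cmod (\<beta> n))\<^sup>2 \<le>
        (cmod \<mu> * cmod (\<beta> (Suc n)) + cmod (h n))\<^sup>2"
      by (intro power_mono) auto
    also have "\<dots> \<le> cmod \<mu> * (cmod (\<beta> (Suc n)))\<^sup>2 + (cmod (h n))\<^sup>2 / (1 - cmod \<mu>)"
      using assms(2) by (intro square_convex_le) simp_all
    finally show ?thesis .
  qed
  have sh: "summable (\<lambda>n. (cmod (h n))\<^sup>2 / (1 - cmod \<mu>))"
    using assms(3) by (intro summable_divide) (simp add: ell2_def)
  have "(cmod (\<beta> n))\<^sup>2 \<le> (\<Sum>k. B * cmod \<mu> ^ k)\<^sup>2" for n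
    by (intro power_mono bound) simp
  note main = contraction_backward[OF _ this _ sh _ assms(2) conv]
  show ?thesis
  proof
    show "\<beta> (Suc n) = inverse \<mu> * \<beta> n + h n" for n
      using rec[of n] assms(1) by (simp add: field_simps)
    show "\<beta> \<in> ell2"
      using main(1) assms(2) by (simp add: ell2_def)
    show "sqsum \<beta> \<le> sqsum h / (1 - cmod \<mu>)\<^sup>2"
      using main(2) assms(2,3) by (simp add: ell2_def suminf_divide power2_eq_square)
  qed
qed

lemma periodic_bounded:
  fixes f :: "nat \<Rightarrow> 'a::real_normed_vector"
  assumes "s \<ge> 1" and per: "\<And>n. f (n + s) = f n"
  obtains B where "B > 0" "\<And>n. norm (f n) \<le> B"
proof -
  have mult: "f (m + j * s) = f m" for m j
    by (induction j) (simp_all add: per flip: add.assoc, metis per add.assoc add.commute)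
  have "norm (f n) \<le> 1 + (\<Sum>m<s. norm (f m))" for n
  proof -
    have "norm (f n) = norm (f (n mod s))"
      using mult[of "n mod s" "n div s"] by simp
    also have "\<dots> \<le> (\<Sum>m<s. norm (f m))"
      using assms(1) by (intro member_le_sum) auto
    finally show ?thesis by simp
  qed
  moreover have "1 + (\<Sum>m<s. norm (f m)) > 0"
    by (simp add: add_pos_nonneg sum_nonneg)
  ultimately show ?thesis using that by blast
qed

text \<open>Along \<open>n\<close>, \<open>n + s\<close>, \<open>n + 2 * s\<close>, ... the modulus
  never decreases, yet it tends to 0.\<close>

lemma expanding_null:
  fixes u :: "nat \<Rightarrow> complex"
  assumes "s \<ge> 1" "u \<longlonglongrightarrow> 0" "cmod w \<ge> 1" and step: "\<And>n. u (n + s) = w * u n"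
  shows "u n = 0"
proof -
  have iter: "u (n + s * j) = w ^ j * u n" for j
  proof (induction j)
    case (Suc j)
    have "u (n + s * Suc j) = u ((n + s * j) + s)"
      by (simp add: ac_simps)
    thus ?case using Suc by (simp add: step)
  qed simp
  have "strict_mono (\<lambda>j. n + s * j)"
    using assms(1) by (intro strict_monoI) auto
  from LIMSEQ_subseq_LIMSEQ[OF assms(2) this]
  have lim: "(\<lambda>j. cmod (w ^ j * u n)) \<longlonglongrightarrow> 0"
    by (simp add: o_def iter tendsto_norm_zero_iff)
  have "cmod (u n) \<le> cmod (w ^ j * u n)" for j
    using mult_right_mono[OF one_le_power[OF assms(3), of j] norm_ge_zero[of "u n"]]
    by (simp add: norm_mult norm_power)
  hence "cmod (u n) \<le> 0"
    by (intro LIMSEQ_le_const[OF lim]) auto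
  thus ?thesis by simp
qed

section \<open>The three-term recurrence\<close>

text \<open>The state \<open>(x n, y n)\<close> of a solution of the recurrence is the pair
  \<open>(a (n - 1) * y (n - 1), y n)\<close>; the row vector \<open>(x n, y n)\<close> times \<open>W\<^sub>n\<close> is
  \<open>(x (n + 1), y (n + 1))\<close> when \<open>g = 0\<close>. The solutions \<open>(x1, y1)\<close> and \<open>(x2, y2)\<close> are the rows
  of the fundamental matrix, so the monodromy matrix has rows \<open>(x1 s, y1 s)\<close> and \<open>(x2 s, y2 s)\<close>.\<close>

definition jacobi_orbit ::
  "(nat \<Rightarrow> complex) \<Rightarrow> (nat \<Rightarrow> complex) \<Rightarrow> (nat \<Rightarrow> complex) \<Rightarrow> (nat \<Rightarrow> complex) \<Rightarrow> (nat \<Rightarrow> complex) \<Rightarrow> bool"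
where
  "jacobi_orbit a q g x y \<longleftrightarrow>
     (\<forall>n. x (Suc n) = a n * y n \<and> a n * y (Suc n) = q n * y n - x n + g n)"

lemma jacobi_orbit_comb:
  assumes "jacobi_orbit a q g x y" "jacobi_orbit a q h u v"
  shows "jacobi_orbit a q (\<lambda>n. c * g n + d * h n) (\<lambda>n. c * x n + d * u n) (\<lambda>n. c * y n + d * v n)"
  using assms
  by (auto simp: jacobi_orbit_def distrib_left right_diff_distrib mult.left_commute[of "a _"])

locale periodic_jacobi =
  fixes s :: nat and a q x1 y1 x2 y2 :: "nat \<Rightarrow> complex"
  assumes s_pos: "s \<ge> 1"
    and a_nz: "a n \<noteq> 0"
    and a_per: "a (n + s) = a n"
    and q_per: "q (n + s) = q n"
    and orbit1: "jacobi_orbit a q (\<lambda>_. 0) x1 y1" "x1 0 = 1" "y1 0 = 0"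
    and orbit2: "jacobi_orbit a q (\<lambda>_. 0) x2 y2" "x2 0 = 0" "y2 0 = 1"
begin

abbreviation "orbit \<equiv> jacobi_orbit a q"

lemmas orbit_def = jacobi_orbit_def[of a q]

lemmas orbit_comb = jacobi_orbit_comb[of a q]

lemma orbit_shift:
  assumes "orbit g x y"
  shows "orbit (\<lambda>n. g (n + s)) (\<lambda>n. x (n + s)) (\<lambda>n. y (n + s))"
  unfolding orbit_def
proof
  fix n
  show "x (Suc n + s) = a n * y (n + s) \<and>
      a n * y (Suc n + s) = q n * y (n + s) - x (n + s) + g (n + s)"
    using assms[unfolded orbit_def, rule_format, of "n + s"] by (simp add: a_per q_per)
qed

lemma orbit_zero:
  assumes "orbit (\<lambda>_. 0) x y" "x 0 = 0" "y 0 = 0"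
  shows "x n = 0 \<and> y n = 0"
proof (induction n)
  case (Suc n)
  have "x (Suc n) = a n * y n" "a n * y (Suc n) = q n * y n - x n"
    using assms(1) by (auto simp: orbit_def)
  thus ?case using Suc a_nz[of n] by simp
qed (use assms in auto)

lemma orbit_eqI:
  assumes "orbit g x y" "orbit g u v" "x 0 = u 0" "y 0 = v 0"
  shows "x n = u n" "y n = v n"
proof -
  have "orbit (\<lambda>_. 0) (\<lambda>n. 1 * x n + (-1) * u n) (\<lambda>n. 1 * y n + (-1) * v n)"
    using orbit_comb[OF assms(1,2), of 1 "-1"] by simp
  from orbit_zero[OF this, of n] show "x n = u n" "y n = v n"
    using assms(3,4) by auto
qed

lemma orbit_fundamental:
  assumes "orbit (\<lambda>_. 0) x y"
  shows "x n = x 0 * x1 n + y 0 * x2 n" "y n = x 0 * y1 n + y 0 * y2 n"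
proof -
  have *: "orbit (\<lambda>_. 0) (\<lambda>n. x 0 * x1 n + y 0 * x2 n) (\<lambda>n. x 0 * y1 n + y 0 * y2 n)"
    using orbit_comb[OF orbit1(1) orbit2(1)] by simp
  show "x n = x 0 * x1 n + y 0 * x2 n" "y n = x 0 * y1 n + y 0 * y2 n"
    by (rule orbit_eqI[OF assms *]; simp add: orbit1 orbit2)+
qed

text \<open>The step matrix with rows \<open>(0, -1 / a n)\<close> and
  \<open>(a n, q n / a n)\<close> has determinant 1, since the same \<open>a n\<close> occurs in
  both parts of the recurrence.\<close>

lemma wronskian:
  assumes "orbit (\<lambda>_. 0) x y" "orbit (\<lambda>_. 0) u v"
  shows "x n * v n - u n * y n = x 0 * v 0 - u 0 * y 0"
proof (induction n)
  case (Suc n)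
  have "x (Suc n) = a n * y n" "a n * y (Suc n) = q n * y n - x n"
    "u (Suc n) = a n * v n" "a n * v (Suc n) = q n * v n - u n"
    using assms by (auto simp: orbit_def)
  hence "x (Suc n) * v (Suc n) - u (Suc n) * y (Suc n) =
      y n * (q n * v n - u n) - v n * (q n * y n - x n)"
    by (metis mult.assoc mult.commute)
  also have "\<dots> = x n * v n - u n * y n"
    by (simp add: algebra_simps)
  finally show ?case using Suc by simp
qed simp

lemma det_monodromy: "x1 s * y2 s - y1 s * x2 s = 1"
  using wronskian[OF orbit1(1) orbit2(1), of s] by (simp add: orbit1 orbit2 mult.commute)

text \<open>By periodicity the difference of the two sides is again an orbit, so it vanishes once
  its initial state does. There the claim is the characteristic equation of a 2 by 2 matrix of
  determinant 1.\<close>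

lemma cayley_hamilton:
  assumes "orbit (\<lambda>_. 0) x y"
  shows "x (n + s + s) = (x1 s + y2 s) * x (n + s) - x n"
    "y (n + s + s) = (x1 s + y2 s) * y (n + s) - y n"
proof -
  let ?t = "x1 s + y2 s"
  note o1 = orbit_shift[OF assms]
  note o2 = orbit_shift[OF o1]
  have "orbit (\<lambda>_. 0) (\<lambda>n. 1 * (?t * x (n + s) + (-1) * x n) + (-1) * x (n + s + s))
      (\<lambda>n. 1 * (?t * y (n + s) + (-1) * y n) + (-1) * y (n + s + s))" (is "orbit _ ?u ?v")
    using orbit_comb[OF orbit_comb[OF o1 assms, of ?t "-1"] o2, of 1 "-1"] by simp
  moreover have "x s = x 0 * x1 s + y 0 * x2 s" "y s = x 0 * y1 s + y 0 * y2 s"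
    "x (s + s) = x s * x1 s + y s * x2 s" "y (s + s) = x s * y1 s + y s * y2 s"
    using orbit_fundamental[OF assms, of s] orbit_fundamental[OF o1, of s] by auto
  hence "?u 0 = x 0 * ((x1 s * y2 s - y1 s * x2 s) - 1)" "?v 0 = y 0 * ((x1 s * y2 s - y1 s * x2 s) - 1)"
    by (simp_all add: algebra_simps)
  hence "?u 0 = 0" "?v 0 = 0"
    by (simp_all only: det_monodromy) simp_all
  ultimately have "?u n = 0 \<and> ?v n = 0"
    by (rule orbit_zero)
  thus "x (n + s + s) = ?t * x (n + s) - x n" "y (n + s + s) = ?t * y (n + s) - y n"
    by auto
qed

lemma orbit_tendsto_0:
  assumes "orbit (\<lambda>_. 0) x y" "y \<in> ell2"
  shows "x \<longlonglongrightarrow> 0" "y \<longlonglongrightarrow> 0"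
proof -
  show y: "y \<longlonglongrightarrow> 0"
    using assms(2) by (rule ell2_tendsto_0)
  obtain B where B: "\<And>n. cmod (a n) \<le> B"
    using periodic_bounded[of s a] s_pos a_per by blast
  have "(\<lambda>n. x (Suc n)) \<longlonglongrightarrow> 0"
  proof (rule tendsto_0_le[OF y, of _ B])
    show "\<forall>\<^sub>F n in sequentially. cmod (x (Suc n)) \<le> cmod (y n) * B"
      using assms(1) B
      by (auto simp: orbit_def norm_mult mult.commute[of _ B] intro!: always_eventually mult_right_mono)
  qed
  thus "x \<longlonglongrightarrow> 0" by (rule LIMSEQ_imp_Suc)
qed

text \<open>The multiplier of a decaying solution is the root \<open>w\<close> that goes with the non-contracting
  root \<open>w'\<close>: by the theorem of Cayley and Hamilton \<open>x (n + s) - w * x n\<close> is multiplied by \<open>w'\<close>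
  over each period, and it tends to \<open>0\<close>.\<close>

lemma ell2_orbit_multiplier:
  assumes "orbit (\<lambda>_. 0) x y" "y \<in> ell2"
    and w: "w + w' = x1 s + y2 s" "w * w' = 1" "cmod w' \<ge> 1"
  shows "x (n + s) = w * x n" "y (n + s) = w * y n"
proof -
  have *: "u (n + s) - w * u n = 0"
    if "\<And>n. u (n + s + s) = (x1 s + y2 s) * u (n + s) - u n" "u \<longlonglongrightarrow> 0" for u
  proof (rule expanding_null[OF s_pos _ w(3)])
    show "(\<lambda>n. u (n + s) - w * u n) \<longlonglongrightarrow> 0"
      using tendsto_diff[OF LIMSEQ_ignore_initial_segment[OF that(2)] tendsto_mult_left[OF that(2)], of s w]
      by simp
    fix n
    have "u (n + s + s) - w * u (n + s) = (w + w') * u (n + s) - (w * w') * u n - w * u (n + s)"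
      by (simp add: that(1) w)
    also have "\<dots> = w' * (u (n + s) - w * u n)"
      by (simp add: algebra_simps)
    finally show "u (n + s + s) - w * u (n + s) = w' * (u (n + s) - w * u n)" .
  qed
  show "x (n + s) = w * x n" "y (n + s) = w * y n"
    using *[of x] *[of y] cayley_hamilton[OF assms(1)] orbit_tendsto_0[OF assms(1,2)] by simp_all
qed

text \<open>A decaying orbit gains the factor \<open>w\<close> over each period, and as
  \<open>w\<close> has modulus 1 too, this excludes decay unless the orbit is zero.\<close>

lemma ell2_orbit_elliptic:
  assumes "orbit (\<lambda>_. 0) x y" "y \<in> ell2"
    and w: "w + w' = x1 s + y2 s" "w * w' = 1" "cmod w = 1" "cmod w' = 1"
  shows "x n = 0" "y n = 0"
  using expanding_null[of s x w] expanding_null[of s y w] s_pos w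
    orbit_tendsto_0[OF assms(1,2)] ell2_orbit_multiplier[OF assms(1,2), of w w'] by auto

text \<open>At index 0 the multiplier relation says that the row \<open>(0, y 0)\<close> is an
  eigenvector of the monodromy matrix for \<open>w\<close>. Comparing entries gives
  \<open>x2 s = 0\<close> and \<open>y2 s = w\<close>.\<close>

lemma ell2_orbit_hyperbolic:
  assumes "orbit (\<lambda>_. 0) x y" "y \<in> ell2" "x 0 = 0" "y 0 \<noteq> 0"
    and w: "w + w' = x1 s + y2 s" "w * w' = 1" "cmod w < 1"
  shows "x2 s = 0" "cmod (y2 s) < 1"
proof -
  have "cmod w * cmod w' = 1"
    using w(2) by (metis norm_mult norm_one)
  moreover have "cmod w * cmod w' \<le> 1 * cmod w'"
    using w(3) by (intro mult_right_mono) auto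
  ultimately have "cmod w' \<ge> 1" by simp
  from ell2_orbit_multiplier[OF assms(1,2) w(1,2) this, of 0]
  have "y 0 * x2 s = 0" "y 0 * y2 s = y 0 * w"
    using orbit_fundamental[OF assms(1), of s] assms(3) by (auto simp: mult.commute)
  thus "x2 s = 0" "cmod (y2 s) < 1"
    using assms(4) w(3) by auto
qed

text \<open>Under these conditions \<open>(0, 1)\<close> is an eigenvector with eigenvalue
  \<open>y2 s\<close>, so each period shrinks \<open>y2\<close> by this factor.\<close>

lemma decaying_orbit:
  assumes "x2 s = 0" "cmod (y2 s) < 1"
  shows "y2 \<in> ell2"
proof -
  have "y2 (n + s) = y2 s * y2 n" for n
    using orbit_fundamental(2)[OF orbit_shift[OF orbit2(1)]] assms by simp
  hence step: "(cmod (y2 (n + s)))\<^sup>2 \<le> (cmod (y2 s))\<^sup>2 * (cmod (y2 n))\<^sup>2 + 0" for n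
    by (simp add: norm_mult power_mult_distrib)
  have less: "(cmod (y2 s))\<^sup>2 < 1"
    using assms(2) by (simp add: power_less_one_iff)
  show ?thesis
    unfolding ell2_def mem_Collect_eq
    by (rule contraction_forward(1)[where A = "\<lambda>n. (cmod (y2 n))\<^sup>2" and F = "\<lambda>_. 0", OF _ _ _ _ less step])
      simp_all
qed

text \<open>An orbit starting in an eigenvector gains the factor \<open>w\<close> per period, so
  dividing by \<open>\<mu> ^ n\<close> leaves periodic, hence bounded, sequences \<open>u\<close>
  and \<open>v\<close>. The factored form keeps all growth in the scalar
  \<open>\<mu> ^ n\<close>.\<close>

lemma floquet:
  assumes w: "w + w' = x1 s + y2 s" "w * w' = 1" and \<mu>: "\<mu> ^ s = w"
  obtains u v B where "orbit (\<lambda>_. 0) (\<lambda>n. \<mu> ^ n * u n) (\<lambda>n. \<mu> ^ n * v n)"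
    "u 0 \<noteq> 0 \<or> v 0 \<noteq> 0" "u 0 * x1 s + v 0 * x2 s = w * u 0" "u 0 * y1 s + v 0 * y2 s = w * v 0"
    "\<forall>n. cmod (u n) \<le> B" "\<forall>n. cmod (v n) \<le> B"
proof -
  have \<mu>0: "\<mu> \<noteq> 0"
    using \<mu> w(2) s_pos by (auto simp: power_0_left)
  have "(w - x1 s) * (w - y2 s) = w * w - (w + w') * w + (x1 s * y2 s - y1 s * x2 s) + y1 s * x2 s"
    unfolding w(1) by (simp add: algebra_simps)
  also have "\<dots> = y1 s * x2 s"
    unfolding det_monodromy using w(2) by (simp add: algebra_simps)
  finally have char: "(w - x1 s) * (w - y2 s) = y1 s * x2 s" .
  \<comment> \<open>The cases only select a nonzero left eigenvector; that the first two candidates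
    are eigenvectors follows from \<open>char\<close>.\<close>
  obtain \<xi> \<eta> where ev: "\<xi> \<noteq> 0 \<or> \<eta> \<noteq> 0" "\<xi> * x1 s + \<eta> * x2 s = w * \<xi>" "\<xi> * y1 s + \<eta> * y2 s = w * \<eta>"
  proof (cases "x2 s = 0")
    case False
    show thesis
      by (rule that[of "x2 s" "w - x1 s"]) (use False char in \<open>auto simp: algebra_simps\<close>)
  next
    case True
    show thesis
    proof (cases "w = y2 s")
      case False
      show thesis
        by (rule that[of "w - y2 s" "y1 s"]) (use True False char in \<open>auto simp: algebra_simps\<close>)
    qed (use that[of 0 1] True in auto)
  qed
  define x where "x n = \<xi> * x1 n + \<eta> * x2 n" for n
  define y where "y n = \<xi> * y1 n + \<eta> * y2 n" for n
  have o: "orbit (\<lambda>_. 0) x y"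
    using orbit_comb[OF orbit1(1) orbit2(1), of \<xi> \<eta>] by (simp add: x_def[abs_def] y_def[abs_def])
  have s: "x s = w * \<xi>" "y s = w * \<eta>"
    using ev by (simp_all add: x_def y_def)
  have mult: "x (n + s) = w * x n" "y (n + s) = w * y n" for n
    using orbit_fundamental[OF orbit_shift[OF o], of n, unfolded add_0 s]
    by (simp_all add: x_def[of n] y_def[of n] algebra_simps)
  define u where "u n = x n / \<mu> ^ n" for n
  define v where "v n = y n / \<mu> ^ n" for n
  have w0: "w \<noteq> 0" using w(2) by auto
  have per: "u (n + s) = u n" "v (n + s) = v n" for n
    using mult[of n] \<mu>0 w0 by (simp_all add: u_def v_def power_add \<mu>)
  obtain B1 where B1: "\<And>n. cmod (u n) \<le> B1"
    using periodic_bounded[of s u] s_pos per(1) by blast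
  obtain B2 where B2: "\<And>n. cmod (v n) \<le> B2"
    using periodic_bounded[of s v] s_pos per(2) by blast
  show thesis
  proof (rule that[of u v "max B1 B2"])
    show "orbit (\<lambda>_. 0) (\<lambda>n. \<mu> ^ n * u n) (\<lambda>n. \<mu> ^ n * v n)"
      using o \<mu>0 by (simp add: u_def v_def)
  qed (use ev B1 B2 in \<open>auto simp: u_def v_def x_def y_def orbit1 orbit2 intro: max.coboundedI1 max.coboundedI2\<close>)
qed

text \<open>The constants of the homogeneous solution become sequences that absorb the powers of
  \<open>\<mu>\<close>, which leaves scalar recursions with constant multipliers. The weights of
  \<open>g n\<close> come from Cramer's rule with determinant \<open>\<delta>\<close>: they cancel
  in the first component and contribute \<open>g n / a n\<close> to the second.\<close>

lemma variation_of_constants: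
  assumes "\<mu> \<noteq> 0"
    and o1: "orbit (\<lambda>_. 0) (\<lambda>n. \<mu> ^ n * u1 n) (\<lambda>n. \<mu> ^ n * v1 n)"
    and o2: "orbit (\<lambda>_. 0) (\<lambda>n. inverse \<mu> ^ n * u2 n) (\<lambda>n. inverse \<mu> ^ n * v2 n)"
    and \<delta>: "u1 0 * v2 0 - u2 0 * v1 0 = \<delta>" "\<delta> \<noteq> 0"
    and \<alpha>: "\<And>n. \<alpha> (Suc n) = \<mu> * \<alpha> n + - u2 (Suc n) / (a n * \<delta>) * g n"
    and \<beta>: "\<And>n. \<beta> (Suc n) = inverse \<mu> * \<beta> n + u1 (Suc n) / (a n * \<delta>) * g n"
  shows "orbit g (\<lambda>n. \<alpha> n * u1 n + \<beta> n * u2 n) (\<lambda>n. \<alpha> n * v1 n + \<beta> n * v2 n)"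
proof -
  define \<nu> where "\<nu> = inverse \<mu>"
  have \<mu>\<nu>: "\<mu> * \<nu> = 1" "\<nu> \<noteq> 0"
    using assms(1) by (simp_all add: \<nu>_def)
  have step: "\<kappa> * u (Suc n) = a n * v n \<and> a n * (\<kappa> * v (Suc n)) = q n * v n - u n"
    if "\<kappa> \<noteq> 0" "orbit (\<lambda>_. 0) (\<lambda>n. \<kappa> ^ n * u n) (\<lambda>n. \<kappa> ^ n * v n)" for \<kappa> u v n
  proof -
    have "\<kappa> ^ n * (\<kappa> * u (Suc n)) = \<kappa> ^ n * (a n * v n)"
      "\<kappa> ^ n * (a n * (\<kappa> * v (Suc n))) = \<kappa> ^ n * (q n * v n - u n)"
      using that(2)[unfolded orbit_def, rule_format, of n] by (simp_all add: algebra_simps)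
    thus ?thesis using that(1) by simp
  qed
  note s1 = step[OF assms(1) o1] and s2 = step[OF \<mu>\<nu>(2) o2[folded \<nu>_def]]
  \<comment> \<open>The powers of \<open>\<mu>\<close> and of its inverse cancel, so the Wronskian
    of the remaining factors is constant.\<close>
  have W: "u1 n * v2 n - u2 n * v1 n = \<delta>" for n
  proof -
    have "\<mu> ^ n * \<nu> ^ n = 1"
      by (simp add: \<mu>\<nu> flip: power_mult_distrib)
    moreover have "(\<mu> ^ n * \<nu> ^ n) * (u1 n * v2 n - u2 n * v1 n) = \<delta>"
      using wronskian[OF o1 o2[folded \<nu>_def], of n] \<delta>(1) by (simp add: algebra_simps)
    ultimately show ?thesis by simp
  qed
  show ?thesis
    unfolding orbit_def
  proof (intro allI conjI)
    fix n
    have e: "\<alpha> (Suc n) = \<mu> * \<alpha> n - u2 (Suc n) * (g n / (a n * \<delta>))"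
      "\<beta> (Suc n) = \<nu> * \<beta> n + u1 (Suc n) * (g n / (a n * \<delta>))"
      by (simp_all add: \<alpha> \<beta> \<nu>_def)
    have "\<alpha> (Suc n) * u1 (Suc n) + \<beta> (Suc n) * u2 (Suc n) =
        \<alpha> n * (\<mu> * u1 (Suc n)) + \<beta> n * (\<nu> * u2 (Suc n))"
      by (simp add: e algebra_simps)
    also have "\<dots> = a n * (\<alpha> n * v1 n + \<beta> n * v2 n)"
      using s1[of n] s2[of n] by (simp add: algebra_simps)
    finally show "\<alpha> (Suc n) * u1 (Suc n) + \<beta> (Suc n) * u2 (Suc n) =
        a n * (\<alpha> n * v1 n + \<beta> n * v2 n)" .
    have "a n * (\<alpha> (Suc n) * v1 (Suc n) + \<beta> (Suc n) * v2 (Suc n)) =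
        \<alpha> n * (a n * (\<mu> * v1 (Suc n))) + \<beta> n * (a n * (\<nu> * v2 (Suc n))) +
        a n * (g n / (a n * \<delta>)) * (u1 (Suc n) * v2 (Suc n) - u2 (Suc n) * v1 (Suc n))"
      by (simp add: e algebra_simps)
    also have "\<dots> = \<alpha> n * (q n * v1 n - u1 n) + \<beta> n * (q n * v2 n - u2 n) + g n"
      using s1[of n] s2[of n] W[of "Suc n"] a_nz[of n] \<delta>(2) by simp
    finally show "a n * (\<alpha> (Suc n) * v1 (Suc n) + \<beta> (Suc n) * v2 (Suc n)) =
        q n * (\<alpha> n * v1 n + \<beta> n * v2 n) - (\<alpha> n * u1 n + \<beta> n * u2 n) + g n"
      by (simp add: algebra_simps)
  qed
qed

text \<open>In the Floquet basis the inhomogeneous recurrence splits into a contracting scalar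
  recursion, solved forwards, and an expanding one, solved backwards. The latter fixes the initial
  value of \<open>\<beta>\<close>, and \<open>x 0 = 0\<close> can then be met by the initial value of \<open>\<alpha>\<close> because the decaying
  eigenvector is not a multiple of \<open>(0, 1)\<close>.\<close>

lemma hyperbolic_solvable:
  assumes w: "w + w' = x1 s + y2 s" "w * w' = 1" "cmod w < 1"
    and nd: "\<not> (x2 s = 0 \<and> cmod (y2 s) < 1)"
  obtains K where "\<And>g. g \<in> ell2 \<Longrightarrow>
    \<exists>x y. orbit g x y \<and> x 0 = 0 \<and> y \<in> ell2 \<and> sqsum y \<le> K * sqsum g"
proof -
  have w0: "w \<noteq> 0" "w' = inverse w" "w \<noteq> w'"
  proof -
    show "w \<noteq> 0" using w(2) by auto
    thus "w' = inverse w" using w(2) by (simp add: field_simps)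
    show "w \<noteq> w'"
    proof
      assume "w = w'"
      hence "(cmod w)\<^sup>2 = 1" using w(2) by (metis norm_mult norm_one power2_eq_square)
      thus False using w(3) norm_ge_zero[of w] by (auto simp: power2_eq_1_iff simp del: norm_ge_zero)
    qed
  qed
  have "card {z. z ^ s = w} = s"
    using s_pos w0 by (intro card_nth_roots) auto
  hence "{z. z ^ s = w} \<noteq> {}"
    using s_pos by force
  then obtain \<mu> where \<mu>: "\<mu> ^ s = w" by blast
  have \<mu>0: "\<mu> \<noteq> 0"
    using \<mu> w0 s_pos by (auto simp: power_0_left)
  have "cmod \<mu> ^ s < 1"
    using w(3) \<mu> by (metis norm_power)
  hence \<mu>1: "cmod \<mu> < 1"
    using one_le_power[of "cmod \<mu>" s] by (meson not_le)
  have \<mu>': "inverse \<mu> ^ s = w'"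
    by (simp add: power_inverse \<mu> w0)
  have w': "w' + w = x1 s + y2 s" "w' * w = 1"
    using w by (simp_all add: ac_simps)
  obtain u1 v1 B1 where 1: "orbit (\<lambda>_. 0) (\<lambda>n. \<mu> ^ n * u1 n) (\<lambda>n. \<mu> ^ n * v1 n)"
    "u1 0 \<noteq> 0 \<or> v1 0 \<noteq> 0" "u1 0 * x1 s + v1 0 * x2 s = w * u1 0" "u1 0 * y1 s + v1 0 * y2 s = w * v1 0"
    "\<forall>n. cmod (u1 n) \<le> B1" "\<forall>n. cmod (v1 n) \<le> B1"
    by (rule floquet[OF w(1,2) \<mu>]) (rule that)
  obtain u2 v2 B2 where 2: "orbit (\<lambda>_. 0) (\<lambda>n. inverse \<mu> ^ n * u2 n) (\<lambda>n. inverse \<mu> ^ n * v2 n)"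
    "u2 0 \<noteq> 0 \<or> v2 0 \<noteq> 0" "u2 0 * x1 s + v2 0 * x2 s = w' * u2 0" "u2 0 * y1 s + v2 0 * y2 s = w' * v2 0"
    "\<forall>n. cmod (u2 n) \<le> B2" "\<forall>n. cmod (v2 n) \<le> B2"
    by (rule floquet[OF w' \<mu>']) (rule that)
  define \<delta> where "\<delta> = u1 0 * v2 0 - u2 0 * v1 0"
  \<comment> \<open>Eigenvectors of distinct eigenvalues are independent: if
    \<open>\<delta> = 0\<close>, both \<open>u1 0 * u2 0\<close> and \<open>v1 0 * v2 0\<close>
    vanish, and together with \<open>eq\<close> this makes one of the two vectors zero.\<close>
  have \<delta>: "\<delta> \<noteq> 0"
  proof
    assume "\<delta> = 0"
    hence eq: "u1 0 * v2 0 = u2 0 * v1 0" by (simp add: \<delta>_def)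
    have "(w - w') * (u1 0 * u2 0) = (w * u1 0) * u2 0 - (w' * u2 0) * u1 0"
      by (simp add: algebra_simps)
    also have "\<dots> = - x2 s * (u1 0 * v2 0 - u2 0 * v1 0)"
      by (simp add: algebra_simps flip: 1(3) 2(3))
    finally have "u1 0 * u2 0 = 0" using eq w0 by simp
    moreover have "(w - w') * (v1 0 * v2 0) = (w * v1 0) * v2 0 - (w' * v2 0) * v1 0"
      by (simp add: algebra_simps)
    hence "(w - w') * (v1 0 * v2 0) = y1 s * (u1 0 * v2 0 - u2 0 * v1 0)"
      by (simp add: algebra_simps flip: 1(4) 2(4))
    hence "v1 0 * v2 0 = 0" using eq w0 by simp
    ultimately show False using eq 1(2) 2(2) by auto
  qed
  have u10: "u1 0 \<noteq> 0"
  proof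
    assume "u1 0 = 0"
    hence "x2 s = 0" "y2 s = w" using 1(2-4) by auto
    thus False using nd w(3) by simp
  qed
  obtain A where A: "A > 0" "\<And>n. cmod (inverse (a n)) \<le> A"
    using periodic_bounded[of s "\<lambda>n. inverse (a n)"] s_pos a_per by auto
  define M where "M = max B1 B2"
  have M: "cmod (u1 n) \<le> M" "cmod (v1 n) \<le> M" "cmod (u2 n) \<le> M" "cmod (v2 n) \<le> M" for n
    using 1(5,6) 2(5,6) by (auto simp: M_def intro: max.coboundedI1 max.coboundedI2)
  have M0: "M \<ge> 0" using M(1)[of 0] norm_ge_zero order_trans by blast
  define N where "N = M * A / cmod \<delta>"
  have coef: "cmod (u (Suc n) / (a n * \<delta>)) \<le> N" if "\<And>n. cmod (u n) \<le> M" for u n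
  proof -
    have "cmod (u (Suc n)) * cmod (inverse (a n)) \<le> M * A"
      using that A M0 by (intro mult_mono) auto
    thus ?thesis
      using \<delta> by (simp add: N_def norm_mult norm_divide norm_inverse divide_simps)
  qed
  \<comment> \<open>\<open>r\<close> is the size of \<open>\<alpha> 0\<close> relative to
    \<open>\<beta> 0\<close>, forced by \<open>x 0 = 0\<close>. \<open>KB\<close> bounds the
    backward solution and enters \<open>KA\<close> through this initial value; the divisions by
    \<open>\<rho>\<close> come from the two scalar recursions.\<close>
  define r where "r = cmod (u2 0 / u1 0)"
  define \<rho> where "\<rho> = 1 - cmod \<mu>"
  have \<rho>: "\<rho> > 0" using \<mu>1 by (simp add: \<rho>_def)
  define KB where "KB = N\<^sup>2 / \<rho>\<^sup>2"
  define KA where "KA = (r\<^sup>2 * KB + N\<^sup>2 / \<rho>) / \<rho>"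
  show thesis
  proof (rule that)
    fix g assume g: "g \<in> ell2"
    define f1 where "f1 n = - u2 (Suc n) / (a n * \<delta>) * g n" for n
    define f2 where "f2 n = u1 (Suc n) / (a n * \<delta>) * g n" for n
    have f1: "f1 \<in> ell2" "sqsum f1 \<le> N\<^sup>2 * sqsum g"
      using ell2_bounded_mult[OF g coef[of "\<lambda>n. - u2 n"]] M unfolding f1_def[abs_def] by simp_all
    have f2: "f2 \<in> ell2" "sqsum f2 \<le> N\<^sup>2 * sqsum g"
      using ell2_bounded_mult[OF g coef[of u1]] M unfolding f2_def[abs_def] by simp_all
    obtain \<beta> where \<beta>: "\<And>n. \<beta> (Suc n) = inverse \<mu> * \<beta> n + f2 n" "\<beta> \<in> ell2"
      "sqsum \<beta> \<le> sqsum f2 / \<rho>\<^sup>2"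
      unfolding \<rho>_def by (rule ell2_unstable_recursion[OF \<mu>0 \<mu>1 f2(1)]) blast
    have "sqsum f2 / \<rho>\<^sup>2 \<le> KB * sqsum g"
      using f2(2) \<rho> by (simp add: KB_def divide_right_mono)
    hence \<beta>K: "sqsum \<beta> \<le> KB * sqsum g"
      using \<beta>(3) by simp
    define \<alpha> where "\<alpha> = rec_nat (- (\<beta> 0 * (u2 0 / u1 0))) (\<lambda>n c. \<mu> * c + f1 n)"
    have \<alpha>: "\<alpha> 0 = - (\<beta> 0 * (u2 0 / u1 0))" "\<alpha> (Suc n) = \<mu> * \<alpha> n + f1 n" for n
      by (simp_all add: \<alpha>_def)
    note \<alpha>L = ell2_stable_recursion[OF \<mu>1 f1(1), of \<alpha>, OF \<alpha>(2), folded \<rho>_def]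
    have "(cmod (\<alpha> 0))\<^sup>2 = r\<^sup>2 * (cmod (\<beta> 0))\<^sup>2"
      by (simp add: \<alpha> r_def norm_mult power_mult_distrib norm_divide power_divide)
    also have "\<dots> \<le> r\<^sup>2 * (KB * sqsum g)"
      using ell2_le_sqsum[OF \<beta>(2), of 0] \<beta>K by (intro mult_left_mono) auto
    finally have "((cmod (\<alpha> 0))\<^sup>2 + sqsum f1 / \<rho>) / \<rho> \<le> (r\<^sup>2 * (KB * sqsum g) + (N\<^sup>2 * sqsum g) / \<rho>) / \<rho>"
      using \<rho> f1(2) by (intro divide_right_mono add_mono) auto
    also have "\<dots> = KA * sqsum g"
      using \<rho> by (simp add: KA_def field_simps)
    finally have \<alpha>K: "sqsum \<alpha> \<le> KA * sqsum g"
      using \<alpha>L(2) by simp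
    define x where "x n = \<alpha> n * u1 n + \<beta> n * u2 n" for n
    define y where "y n = \<alpha> n * v1 n + \<beta> n * v2 n" for n
    have "orbit g x y"
      unfolding x_def[abs_def] y_def[abs_def]
      by (rule variation_of_constants[OF \<mu>0 1(1) 2(1) _ \<delta>]) (simp_all add: \<delta>_def \<alpha> \<beta> f1_def f2_def)
    moreover have "x 0 = 0"
      using u10 by (simp add: x_def \<alpha>)
    moreover have "cmod (y n) \<le> M * (cmod (\<alpha> n) + cmod (\<beta> n))" for n
    proof -
      have "cmod (y n) \<le> cmod (\<alpha> n) * cmod (v1 n) + cmod (\<beta> n) * cmod (v2 n)"
        unfolding y_def by (rule order_trans[OF norm_triangle_ineq]) (simp add: norm_mult)
      also have "\<dots> \<le> cmod (\<alpha> n) * M + cmod (\<beta> n) * M"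
        by (intro add_mono mult_left_mono M) auto
      finally show ?thesis by (simp add: algebra_simps)
    qed
    with \<alpha>L(1) \<beta>(2) have "summable (\<lambda>n. (cmod (y n))\<^sup>2)"
      "sqsum y \<le> 2 * M\<^sup>2 * (sqsum \<alpha> + sqsum \<beta>)"
      using square_sum_le[of "\<lambda>n. cmod (\<alpha> n)" "\<lambda>n. cmod (\<beta> n)" "\<lambda>n. cmod (y n)" M]
      by (auto simp: ell2_def)
    moreover have "2 * M\<^sup>2 * (sqsum \<alpha> + sqsum \<beta>) \<le> 2 * M\<^sup>2 * (KA * sqsum g + KB * sqsum g)"
      using \<alpha>K \<beta>K by (intro mult_left_mono add_mono) auto
    ultimately show "\<exists>x y. orbit g x y \<and> x 0 = 0 \<and> y \<in> ell2 \<and> sqsum y \<le> (2 * M\<^sup>2 * (KA + KB)) * sqsum g"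
      by (intro exI[of _ x] exI[of _ y]) (auto simp: ell2_def algebra_simps)
  qed
qed

end

section \<open>Reduction of the block operator to the recurrence\<close>

text \<open>Periodicity is given for blocks, and this carries it over to the polynomials. The size
  of the matrix gives the degree, its last column all coefficients below the leading one.\<close>

lemma companion_mat_inj:
  assumes "lead_coeff p = 1" "lead_coeff q = 1" "companion_mat p = companion_mat q"
  shows "p = q"
proof (rule poly_eqI)
  fix i
  have deg: "degree p = degree q"
    using arg_cong[OF assms(3), of dim_row] by (simp add: companion_mat_def)
  consider "i < degree p" | "i = degree p" | "i > degree p" by linarith
  thus "coeff p i = coeff q i"
  proof cases
    case 1
    hence "companion_mat p $$ (i, degree p - 1) = - coeff p i"
      "companion_mat q $$ (i, degree p - 1) = - coeff q i"
      using deg by (simp_all add: companion_mat_def)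
    thus ?thesis using assms(3) by simp
  qed (use deg assms in \<open>simp_all add: coeff_eq_0\<close>)
qed

text \<open>Horner's scheme. For \<open>i = k - 1\<close> and \<open>v = u (k - 1)\<close> the terms
  with \<open>v\<close> assemble the value at \<open>z\<close> of the monic polynomial with lower
  coefficients \<open>c\<close>, which is how \<open>p j\<close> emerges from its companion
  block.\<close>

lemma back_substitution:
  fixes u c f :: "nat \<Rightarrow> 'a::comm_ring_1"
  assumes "\<And>i. Suc i < k \<Longrightarrow> u i = z * u (Suc i) + c (Suc i) * v + f (Suc i)" "i < k"
  shows "z * u 0 + c 0 * v + f 0 = z ^ Suc i * u i + (\<Sum>l\<le>i. z ^ l * (c l * v + f l))"
  using assms(2)
proof (induction i)
  case (Suc i)
  have "z ^ Suc i * u i = z ^ Suc i * (z * u (Suc i) + c (Suc i) * v + f (Suc i))"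
    using assms(1)[OF Suc.prems] by simp
  thus ?case using Suc by (simp add: algebra_simps)
qed (simp add: algebra_simps)

text \<open>Induction on the distance \<open>d\<close> from the end of the block. One step costs at
  most the factor \<open>cmod z + M + 1\<close>: \<open>cmod z\<close> for the following entry,
  \<open>M\<close> for the last entry, 1 for the inhomogeneity.\<close>

lemma back_substitution_bound:
  fixes u c f :: "nat \<Rightarrow> complex"
  assumes rec: "\<And>i. Suc i < k \<Longrightarrow> u i = z * u (Suc i) + c (Suc i) * u (k - 1) + f (Suc i)"
    and c: "\<And>i. cmod (c i) \<le> M"
  shows "d < k \<Longrightarrow> cmod (u (k - 1 - d)) \<le>
    (cmod z + M + 1) ^ d * (cmod (u (k - 1)) + (\<Sum>l<k. cmod (f l)))"
proof (induction d)
  case 0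
  show ?case by (simp add: sum_nonneg)
next
  case (Suc d)
  let ?R = "cmod z + M + 1" and ?S = "cmod (u (k - 1)) + (\<Sum>l<k. cmod (f l))"
  define i where "i = k - 1 - Suc d"
  have i: "Suc i < k" "Suc i = k - 1 - d" using Suc.prems by (auto simp: i_def)
  have M: "M \<ge> 0" using c[of 0] norm_ge_zero order_trans by blast
  have S: "?S \<ge> 0" by (intro add_nonneg_nonneg sum_nonneg) auto
  have f: "cmod (f (Suc i)) \<le> (\<Sum>l<k. cmod (f l))"
    using i by (intro member_le_sum) auto
  have R: "?R ^ d \<ge> 1" using M by (intro one_le_power) simp
  have "cmod (u i) \<le> cmod z * cmod (u (Suc i)) + cmod (c (Suc i)) * cmod (u (k - 1)) + cmod (f (Suc i))"
    unfolding rec[OF i(1)]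
    by (rule order_trans[OF norm_triangle_ineq add_mono[OF order_trans[OF norm_triangle_ineq]]])
      (auto simp: norm_mult)
  also have "\<dots> \<le> cmod z * (?R ^ d * ?S) + M * cmod (u (k - 1)) + (\<Sum>l<k. cmod (f l))"
    using Suc i by (intro add_mono mult_mono c f mult_left_mono M) auto
  also have "\<dots> \<le> cmod z * (?R ^ d * ?S) + (M * ?S + 1 * ?S)"
    using M by (simp add: algebra_simps sum_nonneg)
  also have "\<dots> \<le> cmod z * (?R ^ d * ?S) + (M * (?R ^ d * ?S) + 1 * (?R ^ d * ?S))"
    using M S R mult_right_mono[OF R S] by (intro add_mono mult_left_mono) auto
  also have "\<dots> = ?R ^ Suc d * ?S"
    by (simp add: algebra_simps)
  finally show ?case by (simp add: i_def)
qed

section \<open>Rows of the matrix in the flattened index\<close>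

locale generalized_jacobi =
  fixes s :: nat and p :: "nat \<Rightarrow> real poly" and \<epsilon> b :: "nat \<Rightarrow> real"
  assumes s_pos: "s \<ge> 1" and data: "gj_data p \<epsilon> b" and periodic: "gj_periodic s p \<epsilon> b"
begin

abbreviation "k \<equiv> \<lambda>j. degree (p j)"
abbreviation "off \<equiv> block_offset k"
abbreviation "end_pos \<equiv> \<lambda>j. off j + (k j - 1)"
abbreviation "H \<equiv> gj_operator p \<epsilon> b"
abbreviation "cf j i \<equiv> complex_of_real (coeff (p j) i)"

lemma k_pos: "k j \<ge> 1" and lead_one: "lead_coeff (p j) = 1" and b_pos: "b j > 0"
  and eps: "\<epsilon> j = 1 \<or> \<epsilon> j = -1"
  using data by (auto simp: gj_data_def)

lemma eps_mult: "complex_of_real (\<epsilon> j) * (complex_of_real (\<epsilon> j) * c) = c"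
  using eps[of j] by auto

lemma norm_eps: "\<bar>\<epsilon> j\<bar> = 1"
  using eps[of j] by auto

lemma p_per: "p (n + s) = p n" and b_per: "b (n + s) = b n" and eps_per: "\<epsilon> (n + s) = \<epsilon> n"
proof -
  have *: "p (j * s + r) = p r \<and> b (j * s + r) = b r \<and> \<epsilon> (j * s + r) = \<epsilon> r" if "r < s" for j r
  proof (intro conjI)
    from periodic that have D: "companion_mat (p (j * s + r)) = companion_mat (p r)"
      and S: "sub_block p b (j * s + r) = sub_block p b r"
      and "\<epsilon> (j * s + r) = \<epsilon> r"
      by (auto simp: gj_periodic_def diag_block_def)
    thus "\<epsilon> (j * s + r) = \<epsilon> r" by blast
    \<comment> \<open>The polynomial comes first because the position of \<open>b\<close> inside its
      block depends on the degree.\<close>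
    show pp: "p (j * s + r) = p r"
      by (rule companion_mat_inj[OF lead_one lead_one D])
    have "sub_block p b n $$ (0, k n - 1) = b n" for n
      using k_pos[of n] k_pos[of "Suc n"] by (simp add: sub_block_def upper_right_mat_def)
    from this[of "j * s + r"] this[of r] S pp show "b (j * s + r) = b r" by simp
  qed
  have r: "n mod s < s" and eq: "Suc (n div s) * s + n mod s = n + s" "n div s * s + n mod s = n"
    using s_pos by simp_all
  from *[OF r, of "Suc (n div s)", unfolded eq] *[OF r, of "n div s", unfolded eq]
  show "p (n + s) = p n" "b (n + s) = b n" "\<epsilon> (n + s) = \<epsilon> n"
    by simp_all
qed

lemma off_Suc: "off (Suc j) = off j + k j"
  by (simp add: block_offset_def)

lemma position_exists: "\<exists>j i. i < k j \<and> m = off j + i"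
proof (induction m)
  case 0
  show ?case using k_pos[of 0] by (intro exI[of _ 0]) (simp add: block_offset_def)
next
  case (Suc m)
  then obtain j i where ji: "i < k j" "m = off j + i" by blast
  show ?case
  proof (cases "Suc i < k j")
    case True
    thus ?thesis using ji by (intro exI[of _ j] exI[of _ "Suc i"]) simp
  next
    case False
    thus ?thesis using ji k_pos[of "Suc j"]
      by (intro exI[of _ "Suc j"] exI[of _ 0]) (auto simp: off_Suc)
  qed
qed

lemma position_eq_iff:
  assumes "i < k j" "c < k l"
  shows "off j + i = off l + c \<longleftrightarrow> j = l \<and> i = c"
  using block_index_offset[of i k j] block_index_offset[of c k l]
    block_pos_offset[of i k j] block_pos_offset[of c k l] assms by auto

lemma entry:
  assumes "i < k j" "c < k l"
  shows "gjm_entry p \<epsilon> b (off j + i) (off l + c) =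
    (if l = j then (if c = k j - 1 then - coeff (p j) i else if i = Suc c then 1 else 0)
     else if j = Suc l then (if i = 0 \<and> c = k l - 1 then b l else 0)
     else if l = Suc j then (if i = 0 \<and> c = k l - 1 then \<epsilon> j * \<epsilon> l * b j else 0)
     else 0)"
proof -
  have "gjm_entry p \<epsilon> b (off j + i) (off l + c) = gjm_block p \<epsilon> b j l $$ (i, c)"
    unfolding gjm_entry_def Let_def
    using block_index_offset[of i k, OF assms(1)] block_index_offset[of c k, OF assms(2)]
      block_pos_offset[of i k, OF assms(1)] block_pos_offset[of c k, OF assms(2)] by simp
  also have "\<dots> =
    (if l = j then (if c = k j - 1 then - coeff (p j) i else if i = Suc c then 1 else 0)
     else if j = Suc l then (if i = 0 \<and> c = k l - 1 then b l else 0)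
     else if l = Suc j then (if i = 0 \<and> c = k l - 1 then \<epsilon> j * \<epsilon> l * b j else 0)
     else 0)"
  proof -
    consider "l = j" | "j = Suc l" | "l = Suc j" | "l \<noteq> j" "j \<noteq> Suc l" "l \<noteq> Suc j"
      by blast
    thus ?thesis
      using assms by cases (simp_all add: gjm_block_def diag_block_def companion_mat_def
        sub_block_def super_block_def upper_right_mat_def)
  qed
  finally show ?thesis .
qed

lemma H_inner:
  assumes "Suc i < k j"
  shows "H w (off j + Suc i) = w (off j + i) - cf j (Suc i) * w (end_pos j)"
proof -
  have "complex_of_real (gjm_entry p \<epsilon> b (off j + Suc i) n) * w n =
      (if n = off j + i then w n else 0) + (if n = end_pos j then - cf j (Suc i) * w n else 0)" for n
  proof -
    obtain l c where n: "c < k l" "n = off l + c"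
      using position_exists by blast
    have eq: "off l + c = off j + i \<longleftrightarrow> l = j \<and> c = i"
      "off l + c = end_pos j \<longleftrightarrow> l = j \<and> c = k j - 1"
      using position_eq_iff[OF n(1), of i j] position_eq_iff[OF n(1), of "k j - 1" j] assms
      by simp_all
    show ?thesis
      unfolding n(2) entry[OF assms n(1)] eq using assms by (cases "l = j") auto
  qed
  hence "(\<lambda>n. complex_of_real (gjm_entry p \<epsilon> b (off j + Suc i) n) * w n) sums
      (w (off j + i) + - cf j (Suc i) * w (end_pos j))"
    by (simp only:) (intro sums_add sums_single)
  thus ?thesis
    unfolding gj_operator_def by (simp add: sums_iff)
qed

text \<open>The nonzero entries of such a row all stand in last columns of blocks. So the coupling
  between blocks sees only last entries, and this is why the elimination closes.\<close>

lemma H_first: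
  "H w (off j) = (case j of 0 \<Rightarrow> 0 | Suc i \<Rightarrow> complex_of_real (b i) * w (end_pos i))
     - cf j 0 * w (end_pos j) + complex_of_real (\<epsilon> j * \<epsilon> (Suc j) * b j) * w (end_pos (Suc j))"
proof -
  define B where "B = (\<lambda>n. case j of 0 \<Rightarrow> 0 | Suc i \<Rightarrow> if n = end_pos i then complex_of_real (b i) * w n else 0)"
  have B: "B sums (case j of 0 \<Rightarrow> 0 | Suc i \<Rightarrow> complex_of_real (b i) * w (end_pos i))"
  proof (cases j)
    case (Suc i)
    show ?thesis
      unfolding B_def Suc by (simp only: nat.case) (rule sums_single)
  qed (simp add: B_def)
  have "complex_of_real (gjm_entry p \<epsilon> b (off j + 0) n) * w n =
      B n + (if n = end_pos j then - cf j 0 * w n else 0) +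
      (if n = end_pos (Suc j) then complex_of_real (\<epsilon> j * \<epsilon> (Suc j) * b j) * w n else 0)" for n
  proof -
    obtain l c where n: "c < k l" "n = off l + c"
      using position_exists by blast
    have j: "0 < k j"
      using k_pos[of j] by simp
    have "k i - 1 < k i" for i
      using k_pos[of i] by simp
    note eq = position_eq_iff[OF n(1) this]
    have Bn: "B (off l + c) = (if j = Suc l \<and> c = k l - 1 then complex_of_real (b l) * w (off l + c) else 0)"
      unfolding B_def by (cases j) (simp_all only: nat.case eq, auto)
    consider "l = j" | "j = Suc l" | "l = Suc j" | "l \<noteq> j" "j \<noteq> Suc l" "l \<noteq> Suc j"
      by blast
    thus ?thesis
      unfolding n(2) entry[OF j n(1)] Bn eq by cases simp_all
  qed
  hence "(\<lambda>n. complex_of_real (gjm_entry p \<epsilon> b (off j + 0) n) * w n) sums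
      ((case j of 0 \<Rightarrow> 0 | Suc i \<Rightarrow> complex_of_real (b i) * w (end_pos i)) + - cf j 0 * w (end_pos j)
       + complex_of_real (\<epsilon> j * \<epsilon> (Suc j) * b j) * w (end_pos (Suc j)))"
    by (simp only:) (intro sums_add sums_single B)
  thus ?thesis
    unfolding gj_operator_def by (simp add: sums_iff)
qed

section \<open>Elimination of the inner entries of each block\<close>

definition coupling :: "nat \<Rightarrow> complex" where
  "coupling n = complex_of_real (\<epsilon> n * b n)"

definition potential :: "complex \<Rightarrow> nat \<Rightarrow> complex" where
  "potential z n = complex_of_real (\<epsilon> n) * poly (map_poly complex_of_real (p n)) z"

text \<open>What back substitution through block \<open>n\<close> leaves of the inhomogeneity, hence
  the right-hand side of the recurrence.\<close>

definition reduced :: "complex \<Rightarrow> (nat \<Rightarrow> complex) \<Rightarrow> nat \<Rightarrow> complex" where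
  "reduced z f n = (\<Sum>l<k n. z ^ l * f (off n + l))"

definition trace_seq :: "(nat \<Rightarrow> complex) \<Rightarrow> nat \<Rightarrow> complex" where
  "trace_seq w n = complex_of_real (\<epsilon> n) * w (end_pos n)"

definition inner_eq :: "complex \<Rightarrow> (nat \<Rightarrow> complex) \<Rightarrow> (nat \<Rightarrow> complex) \<Rightarrow> bool" where
  "inner_eq z w f \<longleftrightarrow> (\<forall>j i. Suc i < k j \<longrightarrow>
     w (off j + i) = z * w (off j + Suc i) + cf j (Suc i) * w (end_pos j) + f (off j + Suc i))"

lemma poly_p_altdef:
  "poly (map_poly complex_of_real (p j)) z = z ^ k j + (\<Sum>l<k j. cf j l * z ^ l)"
  using lead_one[of j]
  by (simp add: poly_altdef degree_map_poly coeff_map_poly lessThan_Suc_atMost[symmetric])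

text \<open>The rows that are not first in their block are the inner equations. Given those,
  Horner's scheme turns each first row into one step of the recurrence, and the absent block before
  the first becomes the boundary value 0.\<close>

lemma resolvent_equation_iff:
  "(\<forall>m. H w m - z * w m = f m) \<longleftrightarrow> inner_eq z w f \<and>
     jacobi_orbit coupling (potential z) (reduced z f)
       (\<lambda>n. case n of 0 \<Rightarrow> 0 | Suc i \<Rightarrow> coupling i * trace_seq w i) (trace_seq w)"
proof -
  let ?X = "\<lambda>n. case n of 0 \<Rightarrow> 0 | Suc i \<Rightarrow> coupling i * trace_seq w i"
  have "(\<forall>m. H w m - z * w m = f m) \<longleftrightarrow>
      (\<forall>j i. i < k j \<longrightarrow> H w (off j + i) - z * w (off j + i) = f (off j + i))"
    using position_exists by metis
  also have "\<dots> \<longleftrightarrow> (\<forall>j i. Suc i < k j \<longrightarrow>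
        H w (off j + Suc i) - z * w (off j + Suc i) = f (off j + Suc i)) \<and>
      (\<forall>j. H w (off j) - z * w (off j) = f (off j))" (is "?L \<longleftrightarrow> ?I \<and> ?Z")
  proof
    assume L: ?L
    show "?I \<and> ?Z"
    proof
      show ?I using L by blast
      show ?Z
      proof
        fix j
        show "H w (off j) - z * w (off j) = f (off j)"
          using L[rule_format, of 0 j] k_pos[of j] by simp
      qed
    qed
  next
    assume IZ: "?I \<and> ?Z"
    show ?L
    proof (intro allI impI)
      fix j i assume "i < k j"
      thus "H w (off j + i) - z * w (off j + i) = f (off j + i)"
        using IZ by (cases i) auto
    qed
  qed
  also have "?I \<longleftrightarrow> inner_eq z w f"
  proof -
    have "H w (off j + Suc i) - z * w (off j + Suc i) = f (off j + Suc i) \<longleftrightarrow>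
        w (off j + i) = z * w (off j + Suc i) + cf j (Suc i) * w (end_pos j) + f (off j + Suc i)"
      if "Suc i < k j" for i j
      unfolding H_inner[OF that] by (auto simp: algebra_simps)
    thus ?thesis unfolding inner_eq_def by blast
  qed
  also have "inner_eq z w f \<and> ?Z \<longleftrightarrow> inner_eq z w f \<and>
      jacobi_orbit coupling (potential z) (reduced z f) ?X (trace_seq w)"
  proof (intro conj_cong refl)
    assume "inner_eq z w f"
    hence rec: "w (off j + i) = z * w (off j + Suc i) + cf j (Suc i) * w (end_pos j) + f (off j + Suc i)"
      if "Suc i < k j" for i j
      using that by (auto simp: inner_eq_def)
    have first: "z * w (off j) + cf j 0 * w (end_pos j) + f (off j) =
        poly (map_poly complex_of_real (p j)) z * w (end_pos j) + reduced z f j" for j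
    proof -
      have k: "k j - 1 < k j" "{..k j - 1} = {..<k j}" "Suc (k j - 1) = k j"
        using k_pos[of j] by auto
      have "z * w (off j) + cf j 0 * w (end_pos j) + f (off j) =
          z ^ k j * w (end_pos j) + (\<Sum>l<k j. z ^ l * (cf j l * w (end_pos j) + f (off j + l)))"
        using back_substitution[of "k j" "\<lambda>i. w (off j + i)" z "cf j" "w (end_pos j)"
            "\<lambda>i. f (off j + i)", OF rec k(1)] unfolding k by simp
      thus ?thesis
        by (simp add: poly_p_altdef reduced_def sum.distrib distrib_left distrib_right
            sum_distrib_left sum_distrib_right mult_ac)
    qed
    have X: "?X j = (case j of 0 \<Rightarrow> 0 | Suc i \<Rightarrow> complex_of_real (b i) * w (end_pos i))" for j
      by (cases j) (auto simp: coupling_def trace_seq_def eps_mult mult_ac)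
    have "H w (off j) - z * w (off j) = f (off j) \<longleftrightarrow>
        coupling j * trace_seq w (Suc j) = potential z j * trace_seq w j - ?X j + reduced z f j" for j
    proof -
      have "coupling j * trace_seq w (Suc j) =
          complex_of_real (\<epsilon> j * \<epsilon> (Suc j) * b j) * w (end_pos (Suc j))"
        by (simp add: coupling_def trace_seq_def)
      moreover have "potential z j * trace_seq w j = poly (map_poly complex_of_real (p j)) z * w (end_pos j)"
        using eps_mult[of j] by (simp add: potential_def trace_seq_def mult_ac)
      ultimately show ?thesis
        using first[of j] unfolding H_first X by (auto simp: algebra_simps)
    qed
    thus "?Z \<longleftrightarrow> jacobi_orbit coupling (potential z) (reduced z f) ?X (trace_seq w)"
      by (simp add: jacobi_orbit_def)
  qed
  finally show ?thesis .
qed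

lemma inner_eq_extend: "\<exists>w. inner_eq z w f \<and> trace_seq w = y"
proof -
  \<comment> \<open>\<open>B j d\<close> is the entry at distance \<open>d\<close> from the end of
    block \<open>j\<close>. The last entry is recovered from \<open>y j\<close> because
    \<open>\<epsilon> j\<close> is its own inverse.\<close>
  define B where "B j = rec_nat (complex_of_real (\<epsilon> j) * y j)
    (\<lambda>d c. z * c + cf j (k j - 1 - d) * (complex_of_real (\<epsilon> j) * y j) + f (off j + (k j - 1 - d)))" for j
  have B: "B j 0 = complex_of_real (\<epsilon> j) * y j"
    "B j (Suc d) = z * B j d + cf j (k j - 1 - d) * (complex_of_real (\<epsilon> j) * y j) + f (off j + (k j - 1 - d))"
    for j d
    by (simp_all add: B_def)
  define w where "w m = B (block_index k m) (k (block_index k m) - 1 - block_pos k m)" for m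
  have w: "w (off j + i) = B j (k j - 1 - i)" if "i < k j" for i j
    using that block_index_offset[of i k j] block_pos_offset[of i k j] by (simp add: w_def)
  have end_w: "w (end_pos j) = complex_of_real (\<epsilon> j) * y j" for j
    using w[of "k j - 1" j] k_pos[of j] by (simp add: B)
  have "inner_eq z w f"
    unfolding inner_eq_def
  proof (intro allI impI)
    fix j i assume i: "Suc i < k j"
    hence "k j - 1 - i = Suc (k j - 1 - Suc i)" "k j - 1 - (k j - 1 - Suc i) = Suc i" by auto
    thus "w (off j + i) = z * w (off j + Suc i) + cf j (Suc i) * w (end_pos j) + f (off j + Suc i)"
      using w[of i j] w[OF i] i by (simp only: end_w) (simp add: B)
  qed
  moreover have "trace_seq w = y"
    using end_w by (simp add: fun_eq_iff trace_seq_def eps_mult)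
  ultimately show ?thesis by blast
qed

lemma orbit_x_eq:
  assumes "jacobi_orbit coupling q g x y" "x 0 = 0"
  shows "x = (\<lambda>n. case n of 0 \<Rightarrow> 0 | Suc i \<Rightarrow> coupling i * y i)"
  using assms by (auto simp: fun_eq_iff jacobi_orbit_def split: nat.splits)

lemma resolvent_solution:
  assumes "jacobi_orbit coupling (potential z) (reduced z f) x y" "x 0 = 0"
  obtains w where "\<And>m. H w m - z * w m = f m" "trace_seq w = y" "inner_eq z w f"
  using inner_eq_extend[of z f y] resolvent_equation_iff[of _ z f] assms orbit_x_eq[OF assms] by metis

section \<open>Comparison of norms over entries and over blocks\<close>

definition block_norm :: "(nat \<Rightarrow> complex) \<Rightarrow> nat \<Rightarrow> real" where
  "block_norm f j = (\<Sum>l<k j. cmod (f (off j + l)))"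

lemma block_norm_nonneg: "0 \<le> block_norm f j"
  by (simp add: block_norm_def sum_nonneg)

lemma le_block_norm: "i < k j \<Longrightarrow> cmod (f (off j + i)) \<le> block_norm f j"
  unfolding block_norm_def by (rule member_le_sum) auto

lemma k_bounded: obtains K where "\<And>j. k j \<le> K"
proof -
  obtain B where B: "\<And>j. norm (real (k j)) \<le> B"
    using periodic_bounded[OF s_pos, of "\<lambda>j. real (k j)"] by (auto simp: p_per)
  have "k j \<le> nat \<lceil>B\<rceil>" for j
    using B[of j] by (simp add: le_nat_iff ceiling_le_iff) linarith
  thus thesis by (rule that)
qed

lemma cf_bounded: obtains M where "\<And>j i. cmod (cf j i) \<le> M"
proof -
  obtain B where B: "\<And>j. norm (\<Sum>i\<le>k j. \<bar>coeff (p j) i\<bar>) \<le> B"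
    using periodic_bounded[OF s_pos, of "\<lambda>j. \<Sum>i\<le>k j. \<bar>coeff (p j) i\<bar>"] by (auto simp: p_per)
  have "cmod (cf j i) \<le> B" for i j
  proof -
    have "\<bar>coeff (p j) i\<bar> \<le> (\<Sum>i\<le>k j. \<bar>coeff (p j) i\<bar>)"
    proof (cases "i \<le> k j")
      case True
      thus ?thesis by (intro member_le_sum[where f = "\<lambda>i. \<bar>coeff (p j) i\<bar>"]) auto
    qed (simp add: coeff_eq_0 sum_nonneg)
    thus ?thesis using B[of j] by simp
  qed
  thus thesis by (rule that)
qed

lemma sum_blocks:
  fixes h :: "nat \<Rightarrow> 'a::comm_monoid_add"
  shows "(\<Sum>m<off n. h m) = (\<Sum>j<n. \<Sum>i<k j. h (off j + i))"
proof (induction n)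
  case (Suc n)
  have "(\<Sum>m<a + c. h m) = (\<Sum>m<a. h m) + (\<Sum>i<c. h (a + i))" for a c
    by (induction c) (simp_all add: add.assoc)
  thus ?case using Suc by (simp add: off_Suc)
qed (simp add: block_offset_def)

lemma le_off: "n \<le> off n"
proof (induction n)
  case (Suc n)
  thus ?case using k_pos[of n] by (simp add: off_Suc)
qed simp

text \<open>Cauchy-Schwarz inside a block compares the sum of moduli with the sum of squares at the
  cost of the block size.\<close>

lemma block_norm_summable:
  assumes "f \<in> ell2" "\<And>j. k j \<le> K"
  shows "summable (\<lambda>j. (block_norm f j)\<^sup>2)" "(\<Sum>j. (block_norm f j)\<^sup>2) \<le> real K * sqsum f"
proof -
  have le: "(block_norm f j)\<^sup>2 \<le> real K * (\<Sum>l<k j. (cmod (f (off j + l)))\<^sup>2)" for j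
  proof -
    have "(block_norm f j)\<^sup>2 \<le> real (k j) * (\<Sum>l<k j. (cmod (f (off j + l)))\<^sup>2)"
      using Cauchy_Schwarz_ineq_sum[of "\<lambda>_. 1" "\<lambda>l. cmod (f (off j + l))" "{..<k j}"]
      by (simp add: block_norm_def)
    also have "\<dots> \<le> real K * (\<Sum>l<k j. (cmod (f (off j + l)))\<^sup>2)"
      using assms(2) by (intro mult_right_mono sum_nonneg) auto
    finally show ?thesis .
  qed
  have bound: "(\<Sum>j<n. (block_norm f j)\<^sup>2) \<le> real K * sqsum f" for n
  proof -
    have "(\<Sum>j<n. (block_norm f j)\<^sup>2) \<le> (\<Sum>j<n. real K * (\<Sum>l<k j. (cmod (f (off j + l)))\<^sup>2))"
      by (intro sum_mono le)
    also have "\<dots> = real K * (\<Sum>m<off n. (cmod (f m))\<^sup>2)"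
      by (simp add: sum_blocks sum_distrib_left)
    also have "\<dots> \<le> real K * sqsum f"
      by (intro mult_left_mono ell2_sum_le assms(1)) simp
    finally show ?thesis .
  qed
  show s: "summable (\<lambda>j. (block_norm f j)\<^sup>2)"
    by (rule summableI_nonneg_bounded[OF _ bound]) simp
  show "(\<Sum>j. (block_norm f j)\<^sup>2) \<le> real K * sqsum f"
    by (rule suminf_le_const[OF s bound])
qed

lemma ell2_of_block_bound:
  assumes c: "\<And>j i. i < k j \<Longrightarrow> cmod (w (off j + i)) \<le> c j" "summable (\<lambda>j. (c j)\<^sup>2)"
    and K: "\<And>j. k j \<le> K"
  shows "w \<in> ell2" "sqsum w \<le> real K * (\<Sum>j. (c j)\<^sup>2)"
proof -
  have bound: "(\<Sum>m<n. (cmod (w m))\<^sup>2) \<le> real K * (\<Sum>j. (c j)\<^sup>2)" for n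
  proof -
    have "(\<Sum>m<n. (cmod (w m))\<^sup>2) \<le> (\<Sum>m<off n. (cmod (w m))\<^sup>2)"
      using le_off[of n] by (intro sum_mono2) auto
    also have "\<dots> = (\<Sum>j<n. \<Sum>i<k j. (cmod (w (off j + i)))\<^sup>2)"
      by (rule sum_blocks)
    also have "\<dots> \<le> (\<Sum>j<n. \<Sum>i<k j. (c j)\<^sup>2)"
      by (intro sum_mono power_mono c) auto
    also have "\<dots> \<le> (\<Sum>j<n. real K * (c j)\<^sup>2)"
      using K by (intro sum_mono) (auto intro: mult_right_mono)
    also have "\<dots> = real K * (\<Sum>j<n. (c j)\<^sup>2)"
      by (simp add: sum_distrib_left)
    also have "\<dots> \<le> real K * (\<Sum>j. (c j)\<^sup>2)"
      using c(2) by (intro mult_left_mono sum_le_suminf) auto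
    finally show ?thesis .
  qed
  have s: "summable (\<lambda>m. (cmod (w m))\<^sup>2)"
    by (rule summableI_nonneg_bounded[OF _ bound]) simp
  thus "w \<in> ell2" by (simp add: ell2_def)
  show "sqsum w \<le> real K * (\<Sum>j. (c j)\<^sup>2)"
    by (rule suminf_le_const[OF s bound])
qed

lemma trace_seq_ell2:
  assumes "w \<in> ell2"
  shows "trace_seq w \<in> ell2"
proof -
  obtain K where K: "\<And>j. k j \<le> K" using k_bounded by blast
  have "(cmod (trace_seq w j))\<^sup>2 \<le> (block_norm w j)\<^sup>2" for j
    using le_block_norm[of "k j - 1" j w] k_pos[of j]
    by (intro power_mono) (auto simp: trace_seq_def norm_mult norm_eps)
  thus ?thesis
    unfolding ell2_def mem_Collect_eq
    by (intro summable_comparison_test'[OF block_norm_summable(1)[OF assms K], of 0]) simp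
qed

lemma reduced_ell2:
  obtains C where "\<And>f. f \<in> ell2 \<Longrightarrow> reduced z f \<in> ell2 \<and> sqsum (reduced z f) \<le> C * sqsum f"
proof -
  obtain K where K: "\<And>j. k j \<le> K" using k_bounded by blast
  define Z where "Z = (1 + cmod z) ^ K"
  have le: "cmod (reduced z f j) \<le> Z * block_norm f j" for f j
  proof -
    have "cmod (reduced z f j) \<le> (\<Sum>l<k j. cmod z ^ l * cmod (f (off j + l)))"
      unfolding reduced_def by (rule order_trans[OF norm_sum]) (simp add: norm_mult norm_power)
    also have "\<dots> \<le> (\<Sum>l<k j. Z * cmod (f (off j + l)))"
    proof (intro sum_mono mult_right_mono)
      fix l assume "l \<in> {..<k j}"
      hence "l \<le> K" using K[of j] by auto
      have "cmod z ^ l \<le> (1 + cmod z) ^ l" by (intro power_mono) auto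
      also have "\<dots> \<le> Z" unfolding Z_def using \<open>l \<le> K\<close> by (intro power_increasing) auto
      finally show "cmod z ^ l \<le> Z" .
    qed auto
    finally show ?thesis by (simp add: block_norm_def sum_distrib_left)
  qed
  show thesis
  proof (rule that)
    fix f assume f: "f \<in> ell2"
    note N = block_norm_summable[OF f K]
    have sq: "(cmod (reduced z f j))\<^sup>2 \<le> Z\<^sup>2 * (block_norm f j)\<^sup>2" for j
      using power_mono[OF le[of f j], of 2] by (simp add: power_mult_distrib)
    have sr: "summable (\<lambda>j. Z\<^sup>2 * (block_norm f j)\<^sup>2)" by (intro summable_mult N)
    have sl: "summable (\<lambda>j. (cmod (reduced z f j))\<^sup>2)"
      by (rule summable_comparison_test'[OF sr, of 0]) (use sq in simp)
    have "sqsum (reduced z f) \<le> (\<Sum>j. Z\<^sup>2 * (block_norm f j)\<^sup>2)"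
      by (rule suminf_le[OF sq sl sr])
    also have "\<dots> = Z\<^sup>2 * (\<Sum>j. (block_norm f j)\<^sup>2)"
      by (rule suminf_mult[OF N(1)])
    also have "\<dots> \<le> Z\<^sup>2 * (real K * sqsum f)"
      by (intro mult_left_mono N) simp
    finally show "reduced z f \<in> ell2 \<and> sqsum (reduced z f) \<le> (Z\<^sup>2 * real K) * sqsum f"
      using sl by (simp add: ell2_def mult.assoc)
  qed
qed

lemma ell2_of_trace:
  "\<exists>C\<ge>0. \<forall>w f. f \<in> ell2 \<longrightarrow> inner_eq z w f \<longrightarrow> trace_seq w \<in> ell2 \<longrightarrow>
    w \<in> ell2 \<and> sqsum w \<le> C * (sqsum (trace_seq w) + sqsum f)"
proof -
  obtain K where K: "\<And>j. k j \<le> K" using k_bounded by blast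
  obtain M where M: "\<And>j i. cmod (cf j i) \<le> M" using cf_bounded by blast
  have M0: "M \<ge> 0" using M[of 0 0] norm_ge_zero order_trans by blast
  define R where "R = (cmod z + M + 1) ^ K"
  have R0: "R \<ge> 0" using M0 by (simp add: R_def)
  have le: "cmod (w (off j + i)) \<le> R * (cmod (trace_seq w j) + block_norm f j)"
    if "inner_eq z w f" "i < k j" for w f j i
  proof -
    have "cmod (w (off j + (k j - 1 - (k j - 1 - i)))) \<le> (cmod z + M + 1) ^ (k j - 1 - i) *
        (cmod (w (end_pos j)) + (\<Sum>l<k j. cmod (f (off j + l))))"
      using that M
      by (intro back_substitution_bound[of "k j" "\<lambda>i. w (off j + i)" z "cf j" "\<lambda>i. f (off j + i)" M])
        (auto simp: inner_eq_def)
    also have "k j - 1 - (k j - 1 - i) = i" using that(2) by auto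
    also have "cmod (w (end_pos j)) = cmod (trace_seq w j)"
      by (simp add: trace_seq_def norm_mult norm_eps)
    also have "(cmod z + M + 1) ^ (k j - 1 - i) * (cmod (trace_seq w j) + (\<Sum>l<k j. cmod (f (off j + l))))
        \<le> R * (cmod (trace_seq w j) + (\<Sum>l<k j. cmod (f (off j + l))))"
      unfolding R_def using K[of j] M0
      by (intro mult_right_mono power_increasing add_nonneg_nonneg sum_nonneg) auto
    finally show ?thesis by (simp add: block_norm_def)
  qed
  \<comment> \<open>The outer \<open>K\<close> counts the entries of a block,
    \<open>2 * R\<^sup>2\<close> comes from squaring a sum of two terms, and \<open>1 + K\<close>
    absorbs the loss in \<open>block_norm_summable\<close>.\<close>
  define C where "C = real K * (2 * R\<^sup>2) * (1 + real K)"
  show ?thesis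
  proof (intro exI[of _ C] conjI allI impI)
    show "C \<ge> 0" by (simp add: C_def)
    fix w f assume f: "f \<in> ell2" and w: "inner_eq z w f" and t: "trace_seq w \<in> ell2"
    define c where "c j = R * (cmod (trace_seq w j) + block_norm f j)" for j
    have c: "summable (\<lambda>j. (c j)\<^sup>2)"
      "(\<Sum>j. (c j)\<^sup>2) \<le> 2 * R\<^sup>2 * (sqsum (trace_seq w) + (\<Sum>j. (block_norm f j)\<^sup>2))"
      using square_sum_le[of "\<lambda>j. cmod (trace_seq w j)" "block_norm f" c R]
        block_norm_summable(1)[OF f K] t R0 block_norm_nonneg[of f]
      by (auto simp: ell2_def c_def abs_mult)
    note b = ell2_of_block_bound[OF le[OF w, folded c_def] c(1) K]
    have "sqsum w \<le> real K * (2 * R\<^sup>2 * (sqsum (trace_seq w) + real K * sqsum f))"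
      using b(2) mult_left_mono[OF c(2), of "real K"] block_norm_summable(2)[OF f K]
        mult_left_mono[OF block_norm_summable(2)[OF f K], of "real K * (2 * R\<^sup>2)"]
      by (simp add: algebra_simps)
    also have "\<dots> \<le> real K * (2 * R\<^sup>2 * ((1 + real K) * (sqsum (trace_seq w) + sqsum f)))"
      using sqsum_nonneg[OF f] sqsum_nonneg[OF t]
      by (intro mult_left_mono) (simp_all add: algebra_simps)
    finally show "sqsum w \<le> C * (sqsum (trace_seq w) + sqsum f)"
      by (simp add: C_def mult.assoc)
    show "w \<in> ell2" by (rule b(1))
  qed
qed

text \<open>A row reaches only into its own block and the two neighbours, so the block norms of
  \<open>w\<close> and their two shifts dominate the image.\<close>

lemma resolvent_map_ell2:
  assumes w: "w \<in> ell2"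
  shows "(\<lambda>m. H w m - z * w m) \<in> ell2"
proof -
  obtain K where K: "\<And>j. k j \<le> K" using k_bounded by blast
  obtain M where M: "\<And>j i. cmod (cf j i) \<le> M" using cf_bounded by blast
  have M0: "M \<ge> 0" using M[of 0 0] norm_ge_zero order_trans by blast
  obtain B where B: "B > 0" "\<And>j. norm (b j) \<le> B"
    using periodic_bounded[OF s_pos, of b] b_per by blast
  define N where "N = block_norm w"
  define N' where "N' j = (case j of 0 \<Rightarrow> 0 | Suc i \<Rightarrow> N i)" for j
  have N0: "N j \<ge> 0" "N' j \<ge> 0" for j
    by (auto simp: N_def N'_def block_norm_nonneg split: nat.splits)
  have sN: "summable (\<lambda>j. (N j)\<^sup>2)"
    unfolding N_def by (rule block_norm_summable(1)[OF w K])
  have sN': "summable (\<lambda>j. (N' j)\<^sup>2)"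
    by (subst summable_Suc_iff[symmetric]) (simp add: N'_def sN)
  have sN1: "summable (\<lambda>j. (N (Suc j))\<^sup>2)"
    using sN by (subst summable_Suc_iff)
  have eN: "cmod (w (end_pos j)) \<le> N j" for j
    unfolding N_def using k_pos[of j] by (intro le_block_norm) auto
  define C where "C = 1 + M + cmod z + B"
  define c where "c j = C * (N j + (N' j + N (Suc j)))" for j
  have C: "cmod (H w (off j + i) - z * w (off j + i)) \<le> c j" if i: "i < k j" for i j
  proof -
    have zw: "cmod (z * w (off j + i)) \<le> cmod z * N j"
      unfolding norm_mult N_def by (intro mult_left_mono le_block_norm i) auto
    have cw: "cmod (cf j i * w (end_pos j)) \<le> M * N j"
      unfolding norm_mult by (intro mult_mono M eN M0) auto
    have "cmod (H w (off j + i)) \<le> N j + M * N j + B * N' j + B * N (Suc j)"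
    proof (cases i)
      case 0
      define u where "u = (case j of 0 \<Rightarrow> 0 | Suc i \<Rightarrow> complex_of_real (b i) * w (end_pos i))"
      define v where "v = complex_of_real (\<epsilon> j * \<epsilon> (Suc j) * b j) * w (end_pos (Suc j))"
      have bw: "cmod (complex_of_real (b l) * w (end_pos n)) \<le> B * N n" for l n
        unfolding norm_mult using B by (intro mult_mono eN) auto
      have u: "cmod u \<le> B * N' j"
        using bw by (auto simp: u_def N'_def split: nat.split)
      have v: "cmod v \<le> B * N (Suc j)"
        using bw[of j "Suc j"] by (simp add: v_def norm_mult abs_mult norm_eps)
      have "cmod (H w (off j + i)) = cmod (u - cf j i * w (end_pos j) + v)"
        by (simp add: 0 H_first u_def v_def)
      also have "\<dots> \<le> cmod u + cmod (cf j i * w (end_pos j)) + cmod v"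
        by (rule order_trans[OF norm_triangle_ineq add_right_mono[OF norm_triangle_ineq4]])
      finally show ?thesis using u v cw N0(1)[of j] by linarith
    next
      case (Suc i')
      have "cmod (H w (off j + i)) \<le> cmod (w (off j + i')) + cmod (cf j i * w (end_pos j))"
        using i by (simp only: Suc H_inner norm_triangle_ineq4)
      moreover have "cmod (w (off j + i')) \<le> N j"
        unfolding N_def using i Suc by (intro le_block_norm) simp
      moreover have "B * N' j \<ge> 0" "B * N (Suc j) \<ge> 0"
        using B(1) N0 by simp_all
      ultimately show ?thesis using cw by linarith
    qed
    hence "cmod (H w (off j + i) - z * w (off j + i)) \<le>
        (N j + M * N j + B * N' j + B * N (Suc j)) + cmod z * N j"
      using zw norm_triangle_ineq4[of "H w (off j + i)" "z * w (off j + i)"] by linarith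
    also have "\<dots> \<le> c j"
    proof -
      have "0 \<le> B * N j" "0 \<le> (1 + M + cmod z) * N' j" "0 \<le> (1 + M + cmod z) * N (Suc j)"
        using B(1) N0 M0 by simp_all
      thus ?thesis by (simp add: c_def C_def algebra_simps)
    qed
    finally show ?thesis .
  qed
  have C0: "C \<ge> 0" using M0 B(1) by (simp add: C_def)
  have "summable (\<lambda>j. (N' j + N (Suc j))\<^sup>2)"
    by (rule square_sum_le(1)[OF sN' sN1, of _ 1]) (use N0 in simp)
  from square_sum_le(1)[OF sN this, of c C] have "summable (\<lambda>j. (c j)\<^sup>2)"
    using N0 C0 by (simp add: c_def abs_mult)
  from ell2_of_block_bound(1)[OF C this K] show ?thesis by simp
qed

end

section \<open>Spectrum and monodromy\<close>

context generalized_jacobi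
begin

text \<open>The first state component belonging to \<open>y\<close>, where \<open>c\<close> takes
  the place of the term with index -1.\<close>

definition first_component :: "complex \<Rightarrow> (nat \<Rightarrow> complex) \<Rightarrow> nat \<Rightarrow> complex" where
  "first_component c y n = (case n of 0 \<Rightarrow> c | Suc i \<Rightarrow> coupling i * y i)"

abbreviation "P n z \<equiv> gj_P p \<epsilon> b n z"
abbreviation "Q n z \<equiv> gj_Q p \<epsilon> b n z"

lemma coupling_nz: "coupling n \<noteq> 0"
  using b_pos[of n] eps[of n] by (auto simp: coupling_def)

text \<open>Multiplying the recurrence of the polynomials by \<open>\<epsilon> j\<close> gives the
  symmetric one. It starts at index 1, and \<open>init\<close> supplies the step at index 0.\<close>

lemma gj_solution_orbit:
  fixes z :: complex and u0 u1 :: "real poly"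
  defines "y \<equiv> \<lambda>n. poly (map_poly complex_of_real (gj_solution p \<epsilon> b u0 u1 n)) z"
  assumes init: "coupling 0 * y 1 = potential z 0 * y 0 - c"
  shows "jacobi_orbit coupling (potential z) (\<lambda>_. 0) (first_component c y) y"
proof -
  interpret map_poly_comm_ring_hom complex_of_real ..
  have "coupling n * y (Suc n) = potential z n * y n - first_component c y n" for n
  proof (cases n)
    case (Suc i)
    have b0: "complex_of_real (b (Suc i)) \<noteq> 0"
      using b_pos[of "Suc i"] by simp
    have "complex_of_real (b (Suc i)) * y (Suc (Suc i)) =
        poly (map_poly complex_of_real (p (Suc i))) z * y (Suc i) -
        complex_of_real (\<epsilon> (Suc i)) * (complex_of_real (\<epsilon> i) * complex_of_real (b i) * y i)"
      using b0 by (simp add: y_def hom_distribs mult_ac)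
    from arg_cong[OF this, of "(*) (complex_of_real (\<epsilon> (Suc i)))"] show ?thesis
      unfolding right_diff_distrib eps_mult by (simp add: Suc coupling_def potential_def first_component_def mult.assoc)
  qed (use init in \<open>simp add: first_component_def\<close>)
  thus ?thesis
    by (simp add: jacobi_orbit_def first_component_def)
qed

lemma periodic_jacobi:
  "periodic_jacobi s coupling (potential z) (first_component 1 (\<lambda>n. - Q n z)) (\<lambda>n. - Q n z)
     (first_component 0 (\<lambda>n. P n z)) (\<lambda>n. P n z)"
proof
  have b0: "complex_of_real (b 0) \<noteq> 0"
    using b_pos[of 0] by simp
  have "coupling 0 * P 1 z = potential z 0 * P 0 z - 0"
    using b0 by (simp add: gj_P_def coupling_def potential_def of_real_hom.map_poly_hom_smult)
  thus "jacobi_orbit coupling (potential z) (\<lambda>_. 0) (first_component 0 (\<lambda>n. P n z)) (\<lambda>n. P n z)"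
    unfolding gj_P_def by (rule gj_solution_orbit)
  \<comment> \<open>\<open>Q\<close> starts in the state \<open>(-1, 0)\<close>, so the fundamental
    solution with initial state \<open>(1, 0)\<close> is \<open>- Q\<close>; hence the minus signs
    in the first row of the monodromy matrix.\<close>
  have "coupling 0 * Q 1 z = potential z 0 * Q 0 z - (-1)"
    using b0 eps[of 0] by (auto simp: gj_Q_def coupling_def map_poly_pCons)
  hence "jacobi_orbit coupling (potential z) (\<lambda>_. 0) (first_component (-1) (\<lambda>n. Q n z)) (\<lambda>n. Q n z)"
    unfolding gj_Q_def by (rule gj_solution_orbit)
  thus "jacobi_orbit coupling (potential z) (\<lambda>_. 0)
      (first_component 1 (\<lambda>n. - Q n z)) (\<lambda>n. - Q n z)"
    by (auto simp: jacobi_orbit_def first_component_def split: nat.splits)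
  show "coupling n \<noteq> 0" for n
    by (rule coupling_nz)
qed (use s_pos in \<open>simp_all add: coupling_def potential_def p_per b_per eps_per
    first_component_def gj_P_def gj_Q_def\<close>)

lemma reduced_zero: "reduced z (\<lambda>_. 0) = (\<lambda>_. 0)"
  by (simp add: reduced_def fun_eq_iff)

lemma trace_determines:
  assumes "inner_eq z w (\<lambda>_. 0)" "trace_seq w = (\<lambda>_. 0)"
  shows "w = (\<lambda>_. 0)"
proof -
  obtain C where C: "\<And>w f. f \<in> ell2 \<Longrightarrow> inner_eq z w f \<Longrightarrow> trace_seq w \<in> ell2 \<Longrightarrow>
      w \<in> ell2 \<and> sqsum w \<le> C * (sqsum (trace_seq w) + sqsum f)"
    using ell2_of_trace by blast
  have "(\<lambda>_. 0) \<in> ell2" by (simp add: ell2_def)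
  with C[OF _ assms(1)] have "w \<in> ell2" "sqsum w \<le> 0"
    using assms(2) by simp_all
  hence "(cmod (w n))\<^sup>2 \<le> 0" for n
    using ell2_le_sqsum[of w n] by linarith
  thus ?thesis by (simp add: fun_eq_iff)
qed

text \<open>An eigenvector and its sequence of last entries determine each other, and square
  summability passes in both directions.\<close>

lemma point_spectrum_iff:
  "z \<in> ell2_point_spectrum H \<longleftrightarrow>
    (\<exists>x y. jacobi_orbit coupling (potential z) (\<lambda>_. 0) x y \<and> x 0 = 0 \<and> y \<in> ell2 \<and> y \<noteq> (\<lambda>_. 0))"
proof
  assume "z \<in> ell2_point_spectrum H"
  then obtain w where w: "w \<in> ell2" "w \<noteq> (\<lambda>_. 0)" "H w = (\<lambda>n. z * w n)"
    by (auto simp: ell2_point_spectrum_def)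
  let ?x = "\<lambda>n. case n of 0 \<Rightarrow> 0 | Suc i \<Rightarrow> coupling i * trace_seq w i"
  have "\<forall>m. H w m - z * w m = 0" using w(3) by simp
  hence "inner_eq z w (\<lambda>_. 0)" "jacobi_orbit coupling (potential z) (\<lambda>_. 0) ?x (trace_seq w)"
    using resolvent_equation_iff[of w z "\<lambda>_. 0"] by (simp_all add: reduced_zero)
  moreover from this(1) w(2) have "trace_seq w \<noteq> (\<lambda>_. 0)"
    using trace_determines by blast
  ultimately show "\<exists>x y. jacobi_orbit coupling (potential z) (\<lambda>_. 0) x y \<and> x 0 = 0 \<and>
      y \<in> ell2 \<and> y \<noteq> (\<lambda>_. 0)"
    using trace_seq_ell2[OF w(1)]
    by (intro exI[of _ ?x] exI[of _ "trace_seq w"]) simp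
next
  assume "\<exists>x y. jacobi_orbit coupling (potential z) (\<lambda>_. 0) x y \<and> x 0 = 0 \<and> y \<in> ell2 \<and> y \<noteq> (\<lambda>_. 0)"
  then obtain x y where xy: "jacobi_orbit coupling (potential z) (reduced z (\<lambda>_. 0)) x y" "x 0 = 0"
    "y \<in> ell2" "y \<noteq> (\<lambda>_. 0)"
    by (auto simp: reduced_zero)
  obtain w where w: "\<And>m. H w m - z * w m = 0" "trace_seq w = y" "inner_eq z w (\<lambda>_. 0)"
    using resolvent_solution[OF xy(1,2)] by blast
  obtain C where C: "\<And>w f. f \<in> ell2 \<Longrightarrow> inner_eq z w f \<Longrightarrow> trace_seq w \<in> ell2 \<Longrightarrow>
      w \<in> ell2 \<and> sqsum w \<le> C * (sqsum (trace_seq w) + sqsum f)"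
    using ell2_of_trace by blast
  have "(\<lambda>_. 0) \<in> ell2" by (simp add: ell2_def)
  hence "w \<in> ell2"
    using C[OF _ w(3)] w(2) xy(3) by blast
  moreover have "w \<noteq> (\<lambda>_. 0)"
  proof
    assume "w = (\<lambda>_. 0)"
    hence "y = (\<lambda>_. 0)" by (simp add: trace_seq_def fun_eq_iff flip: w(2))
    thus False using xy(4) by blast
  qed
  ultimately show "z \<in> ell2_point_spectrum H"
    using w(1) by (auto simp: ell2_point_spectrum_def fun_eq_iff)
qed

lemma point_spectrum_subset: "ell2_point_spectrum H \<subseteq> ell2_spectrum H"
proof
  fix z assume "z \<in> ell2_point_spectrum H"
  then obtain w where w: "w \<in> ell2" "w \<noteq> (\<lambda>_. 0)" "H w = (\<lambda>n. z * w n)"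
    by (auto simp: ell2_point_spectrum_def)
  have "\<not> inj_on (\<lambda>w n. H w n - z * w n) ell2"
  proof
    assume inj: "inj_on (\<lambda>w n. H w n - z * w n) ell2"
    have zero: "(\<lambda>_. 0) \<in> ell2" by (simp add: ell2_def)
    have eq: "(\<lambda>n. H w n - z * w n) = (\<lambda>n. H (\<lambda>_. 0) n - z * 0)"
    proof
      fix n
      have "H w n - z * w n = 0" using w(3) by simp
      thus "H w n - z * w n = H (\<lambda>_. 0) n - z * 0" by (simp add: gj_operator_def)
    qed
    have "w = (\<lambda>_. 0)"
      by (rule inj_onD[OF inj _ w(1) zero]) (rule eq)
    thus False using w(2) by blast
  qed
  thus "z \<in> ell2_spectrum H"
    by (auto simp: ell2_spectrum_def ell2_resolvent_set_def bij_betw_def)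
qed

text \<open>If \<open>(H - z) w\<close> is the first unit vector, then changing the initial state from \<open>x 0 = 0\<close>
  to \<open>x 0 = -1\<close> absorbs the inhomogeneity.\<close>

lemma spectrum_if_no_ell2_orbit:
  assumes "\<And>x y. jacobi_orbit coupling (potential z) (\<lambda>_. 0) x y \<Longrightarrow> y \<in> ell2 \<Longrightarrow> x 0 = 0"
  shows "z \<in> ell2_spectrum H"
proof (rule ccontr)
  define f :: "nat \<Rightarrow> complex" where "f m = (if m = 0 then 1 else 0)" for m
  assume "z \<notin> ell2_spectrum H"
  hence "ell2 = (\<lambda>w n. H w n - z * w n) ` ell2"
    by (auto simp: ell2_spectrum_def ell2_resolvent_set_def bij_betw_def)
  moreover have "f \<in> ell2"
  proof -
    have "(\<lambda>n. (cmod (f n))\<^sup>2) = (\<lambda>n. if n = 0 then 1 else 0)"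
      by (auto simp: f_def)
    thus ?thesis
      using sums_single[of 0 "\<lambda>_. 1 :: real"] by (simp add: ell2_def sums_iff)
  qed
  ultimately obtain w where w: "w \<in> ell2" "f = (\<lambda>n. H w n - z * w n)"
    by auto
  have red: "reduced z f n = (if n = 0 then 1 else 0)" for n
  proof (cases n)
    case 0
    have "reduced z f n = (\<Sum>l<k 0. if l = 0 then 1 else 0)"
      unfolding reduced_def 0 by (intro sum.cong) (auto simp: f_def block_offset_def)
    thus ?thesis using k_pos[of 0] 0 by (simp add: sum.delta)
  next
    case (Suc i)
    hence "off n > 0" using le_off[of n] by simp
    thus ?thesis by (simp add: reduced_def f_def Suc)
  qed
  have "\<forall>m. H w m - z * w m = f m"
    by (simp add: w(2))
  hence "jacobi_orbit coupling (potential z) (reduced z f)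
      (\<lambda>n. case n of 0 \<Rightarrow> 0 | Suc i \<Rightarrow> coupling i * trace_seq w i) (trace_seq w)"
    unfolding resolvent_equation_iff by blast
  hence "jacobi_orbit coupling (potential z) (\<lambda>_. 0)
      (\<lambda>n. case n of 0 \<Rightarrow> -1 | Suc i \<Rightarrow> coupling i * trace_seq w i) (trace_seq w)"
    by (auto simp: jacobi_orbit_def red split: nat.splits)
  from assms[OF this trace_seq_ell2[OF w(1)]] show False by simp
qed

text \<open>Solvability with a bound yields a bounded right inverse. Injectivity, which holds
  because \<open>z\<close> is not an eigenvalue, identifies every \<open>w\<close> with the
  constructed solution for its image and so transfers the bound to it.\<close>

lemma resolvent_set_if_solvable:
  assumes solve: "\<And>g. g \<in> ell2 \<Longrightarrow> \<exists>x y. jacobi_orbit coupling (potential z) g x y \<and> x 0 = 0 \<and>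
      y \<in> ell2 \<and> sqsum y \<le> K * sqsum g"
    and not_ev: "z \<notin> ell2_point_spectrum H"
  shows "z \<in> ell2_resolvent_set H"
proof -
  let ?F = "\<lambda>w n. H w n - z * w n"
  obtain D where D: "\<And>f. f \<in> ell2 \<Longrightarrow> reduced z f \<in> ell2 \<and> sqsum (reduced z f) \<le> D * sqsum f"
    using reduced_ell2[of z] by blast
  obtain C where C: "C \<ge> 0" "\<And>w f. f \<in> ell2 \<Longrightarrow> inner_eq z w f \<Longrightarrow> trace_seq w \<in> ell2 \<Longrightarrow>
    w \<in> ell2 \<and> sqsum w \<le> C * (sqsum (trace_seq w) + sqsum f)"
    using ell2_of_trace by blast
  \<comment> \<open>The signs of \<open>K\<close> and \<open>D\<close> are unknown, hence the
    absolute values; the 1 accounts for the term \<open>sqsum f\<close> in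
    \<open>ell2_of_trace\<close>.\<close>
  define B where "B = C * (\<bar>K\<bar> * \<bar>D\<bar> + 1)"
  have B0: "B \<ge> 0" using C(1) by (simp add: B_def)
  have sol: "\<exists>w\<in>ell2. ?F w = f \<and> sqsum w \<le> B * sqsum f" if f: "f \<in> ell2" for f
  proof -
    obtain x y where xy: "jacobi_orbit coupling (potential z) (reduced z f) x y" "x 0 = 0"
      "y \<in> ell2" "sqsum y \<le> K * sqsum (reduced z f)"
      using solve[of "reduced z f"] D[OF f] by blast
    obtain w where w: "\<And>m. ?F w m = f m" "trace_seq w = y" "inner_eq z w f"
      using resolvent_solution[OF xy(1,2)] by blast
    have "sqsum y \<le> \<bar>K\<bar> * sqsum (reduced z f)"
      using xy(4) D[OF f] by (intro order_trans[OF xy(4) mult_right_mono]) (auto intro: sqsum_nonneg)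
    also have "\<dots> \<le> \<bar>K\<bar> * (\<bar>D\<bar> * sqsum f)"
      using D[OF f] sqsum_nonneg[OF f]
      by (intro mult_left_mono order_trans[OF conjunct2[OF D[OF f]] mult_right_mono]) auto
    finally have "C * (sqsum y + sqsum f) \<le> C * ((\<bar>K\<bar> * \<bar>D\<bar> + 1) * sqsum f)"
      using C(1) by (intro mult_left_mono) (auto simp: algebra_simps)
    with C(2)[OF f w(3)] w(2) xy(3) have "w \<in> ell2" "sqsum w \<le> B * sqsum f"
      by (auto simp: B_def mult.assoc)
    with w(1) show ?thesis by (intro bexI[of _ w]) auto
  qed
  have inj: "w = v" if wv: "w \<in> ell2" "v \<in> ell2" "?F w = ?F v" for w v
  proof -
    define f where "f = ?F w"
    have eqs: "\<forall>m. H w m - z * w m = f m" "\<forall>m. H v m - z * v m = f m"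
      using fun_cong[OF wv(3)] by (simp_all add: f_def)
    note w = eqs(1)[unfolded resolvent_equation_iff] and v = eqs(2)[unfolded resolvent_equation_iff]
    let ?d = "\<lambda>n. w n - v n" and ?t = "\<lambda>n. trace_seq w n - trace_seq v n"
    have d1: "inner_eq z ?d (\<lambda>_. 0)"
      using w v by (simp add: inner_eq_def algebra_simps)
    have d2: "trace_seq ?d = ?t"
      by (simp add: trace_seq_def fun_eq_iff algebra_simps)
    have d3: "?t = (\<lambda>_. 0)"
    proof (rule ccontr)
      assume nz: "?t \<noteq> (\<lambda>_. 0)"
      let ?x = "\<lambda>n. (case n of 0 \<Rightarrow> 0 | Suc i \<Rightarrow> coupling i * trace_seq w i) -
            (case n of 0 \<Rightarrow> 0 | Suc i \<Rightarrow> coupling i * trace_seq v i)"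
      have "jacobi_orbit coupling (potential z) (\<lambda>_. 0) ?x ?t"
        using jacobi_orbit_comb[OF conjunct2[OF w] conjunct2[OF v], of 1 "-1"] by simp
      moreover have "?t \<in> ell2"
        using trace_seq_ell2[OF wv(1)] trace_seq_ell2[OF wv(2)]
        unfolding ell2_def mem_Collect_eq
        by (rule square_sum_le(1)[where M = 1]) (simp add: norm_triangle_ineq4)
      ultimately have "z \<in> ell2_point_spectrum H"
        unfolding point_spectrum_iff using nz by (intro exI[of _ ?x] exI[of _ ?t]) simp
      thus False using not_ev by blast
    qed
    have "?d = (\<lambda>_. 0)"
      by (rule trace_determines[OF d1 trans[OF d2 d3]])
    thus ?thesis by (simp add: fun_eq_iff)
  qed
  have "bij_betw ?F ell2 ell2"
    unfolding bij_betw_def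
  proof
    show "inj_on ?F ell2" using inj by (intro inj_onI)
    show "?F ` ell2 = ell2"
    proof
      show "?F ` ell2 \<subseteq> ell2" by (rule image_subsetI) (rule resolvent_map_ell2)
      show "ell2 \<subseteq> ?F ` ell2"
      proof
        fix f assume "f \<in> ell2"
        from sol[OF this] obtain w where "w \<in> ell2" "?F w = f" by (elim bexE conjE)
        thus "f \<in> ?F ` ell2" by (intro image_eqI[of f ?F w]) simp_all
      qed
    qed
  qed
  moreover have "ell2_norm w \<le> sqrt B * ell2_norm (?F w)" if w: "w \<in> ell2" for w
  proof -
    obtain v where "v \<in> ell2" "?F v = ?F w" "sqsum v \<le> B * sqsum (?F w)"
      using sol[OF resolvent_map_ell2[OF w, of z]] by blast
    with inj[OF _ w] have "sqsum w \<le> B * sqsum (?F w)" by blast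
    thus ?thesis by (simp add: ell2_norm_def flip: real_sqrt_mult)
  qed
  ultimately show ?thesis
    by (auto simp: ell2_resolvent_set_def)
qed

end

lemma char_poly_2:
  fixes a b c d :: "'a::comm_ring_1"
  shows "char_poly (mat_of_rows_list 2 [[a, b], [c, d]]) = [:a * d - b * c, - (a + d), 1:]"
proof -
  define A where "A = char_poly_matrix (mat_of_rows_list 2 [[a, b], [c, d]])"
  have A: "A \<in> carrier_mat 2 2"
    unfolding A_def by (rule char_poly_matrix_closed) (simp add: mat_of_rows_list_def numeral_2_eq_2)
  have "det A = A $$ (0,0) * A $$ (1,1) - A $$ (0,1) * A $$ (1,0)"
    using A by (simp add: laplace_expansion_column[OF A, of 0] cofactor_def numeral_2_eq_2 det_single
        mat_delete_def)
  thus ?thesis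
    by (simp add: char_poly_def A_def char_poly_matrix_def mat_of_rows_list_def algebra_simps)
qed

theorem theorem6p2:
  fixes s :: nat
    and p :: "nat \<Rightarrow> real poly" and \<epsilon> b :: "nat \<Rightarrow> real"
    and w1 w2 :: "complex \<Rightarrow> complex"
  assumes "s \<ge> 1"
    and "gj_data p \<epsilon> b"
    and "gj_periodic s p \<epsilon> b"
    and "\<And>z. char_poly (monodromy_mat s p \<epsilon> b z) = [:- w1 z, 1:] * [:- w2 z, 1:]"
  defines "E \<equiv> {z. cmod (w1 z) = cmod (w2 z)}"
    and "E\<^sub>p \<equiv> {z. gj_P p \<epsilon> b (s - 1) z = 0 \<and>
                  cmod (complex_of_real (b (s - 1)) * gj_Q p \<epsilon> b (s - 1) z) > cmod (gj_P p \<epsilon> b s z)}"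
  shows "ell2_spectrum (gj_operator p \<epsilon> b) = E \<union> E\<^sub>p
       \<and> ell2_point_spectrum (gj_operator p \<epsilon> b) = E\<^sub>p"
proof -
  interpret generalized_jacobi s p \<epsilon> b
    by standard (use assms(1-3) in auto)
  have pointwise: "(z \<in> ell2_point_spectrum H \<longleftrightarrow> z \<in> E\<^sub>p) \<and> (z \<in> ell2_spectrum H \<longleftrightarrow> z \<in> E \<or> z \<in> E\<^sub>p)" for z
  proof -
    let ?x1 = "first_component 1 (\<lambda>n. - Q n z)" and ?y1 = "\<lambda>n. - Q n z"
      and ?x2 = "first_component 0 (\<lambda>n. P n z)" and ?y2 = "\<lambda>n. P n z"
    interpret J: periodic_jacobi s coupling "potential z" ?x1 ?y1 ?x2 ?y2
      by (rule periodic_jacobi)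
    have entries: "?x1 s = - (coupling (s - 1) * Q (s - 1) z)" "?x2 s = coupling (s - 1) * P (s - 1) z"
      using assms(1) by (auto simp: first_component_def split: nat.split)
    have "monodromy_mat s p \<epsilon> b z = mat_of_rows_list 2 [[?x1 s, ?y1 s], [?x2 s, ?y2 s]]"
      by (simp add: monodromy_mat_def Let_def entries coupling_def)
    hence w: "w1 z + w2 z = ?x1 s + ?y2 s" "w1 z * w2 z = 1"
      using assms(4)[of z] J.det_monodromy by (auto simp: char_poly_2 eq_neg_iff_add_eq_0 algebra_simps)
    have norm_w: "cmod (w1 z) * cmod (w2 z) = 1"
      using w(2) by (metis norm_mult norm_one)
    \<comment> \<open>The coupling is nonzero, so \<open>?x2 s\<close> vanishes with
      \<open>P (s - 1) z\<close>. The monodromy matrix is then triangular with reciprocal diagonal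
      entries, and the one of smaller modulus is the contracting one.\<close>
    have Ep: "z \<in> E\<^sub>p \<longleftrightarrow> ?x2 s = 0 \<and> cmod (?y2 s) < 1"
    proof -
      have n: "cmod (complex_of_real (b (s - 1)) * Q (s - 1) z) = cmod (?x1 s)"
        unfolding entries by (simp add: coupling_def norm_mult abs_mult norm_eps)
      have "cmod (?y2 s) < cmod (?x1 s) \<longleftrightarrow> cmod (?y2 s) < 1" if "?x2 s = 0"
      proof -
        have "?x1 s * ?y2 s = 1" using J.det_monodromy that by simp
        hence m: "cmod (?x1 s) * cmod (?y2 s) = 1" by (metis norm_mult norm_one)
        show ?thesis
        proof
          assume "cmod (?y2 s) < cmod (?x1 s)"
          hence "cmod (?y2 s) * cmod (?y2 s) \<le> cmod (?x1 s) * cmod (?y2 s)"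
            by (intro mult_right_mono) auto
          hence "cmod (?y2 s) \<le> 1"
            using m by (simp add: abs_square_le_1[of "cmod (?y2 s)", simplified power2_eq_square])
          moreover have "cmod (?y2 s) \<noteq> 1"
            using m \<open>cmod (?y2 s) < cmod (?x1 s)\<close> by auto
          ultimately show "cmod (?y2 s) < 1" by simp
        next
          assume l: "cmod (?y2 s) < 1"
          have "1 \<le> cmod (?x1 s)"
          proof (rule ccontr)
            assume "\<not> 1 \<le> cmod (?x1 s)"
            hence "cmod (?x1 s) * cmod (?y2 s) < 1 * 1"
              using l by (intro mult_strict_mono') auto
            thus False using m by simp
          qed
          thus "cmod (?y2 s) < cmod (?x1 s)" using l by simp
        qed
      qed
      thus ?thesis
        unfolding E\<^sub>p_def mem_Collect_eq n using coupling_nz[of "s - 1"] entries(2) by auto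
    qed
    \<comment> \<open>Equal moduli with product 1 are both 1.\<close>
    have ell: "cmod (w1 z) = 1" "cmod (w2 z) = 1" if "z \<in> E"
    proof -
      have "cmod (w1 z) * cmod (w1 z) = 1" using that norm_w by (simp add: E_def)
      hence "(cmod (w1 z))\<^sup>2 = 1\<^sup>2" by (simp add: power2_eq_square)
      thus "cmod (w1 z) = 1" by (rule power2_eq_imp_eq) auto
      thus "cmod (w2 z) = 1" using that by (simp add: E_def)
    qed
    have elliptic: "x n = 0 \<and> y n = 0"
      if "z \<in> E" "jacobi_orbit coupling (potential z) (\<lambda>_. 0) x y" "y \<in> ell2" for x y n
      using J.ell2_orbit_elliptic[OF that(2,3) w] ell[OF that(1)] by blast
    \<comment> \<open>\<open>w1\<close> and \<open>w2\<close> come in no particular order, so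
      \<open>u\<close> is whichever of them is contracting at this \<open>z\<close>.\<close>
    have hyp: "\<exists>u v. u + v = ?x1 s + ?y2 s \<and> u * v = 1 \<and> cmod u < 1" if "z \<notin> E"
    proof -
      have "cmod (w1 z) < 1 \<or> cmod (w2 z) < 1"
      proof (rule ccontr)
        assume "\<not> ?thesis"
        hence le: "1 \<le> cmod (w1 z)" "1 \<le> cmod (w2 z)" by auto
        have "cmod (w1 z) \<le> 1" "cmod (w2 z) \<le> 1"
          using mult_left_mono[OF le(2), of "cmod (w1 z)"] mult_right_mono[OF le(1), of "cmod (w2 z)"]
            norm_w by simp_all
        thus False using le that by (simp add: E_def)
      qed
      thus ?thesis using w by (metis add.commute mult.commute)
    qed
    have point: "z \<in> ell2_point_spectrum H \<longleftrightarrow> z \<in> E\<^sub>p"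
    proof
      assume "z \<in> ell2_point_spectrum H"
      then obtain x y where xy: "jacobi_orbit coupling (potential z) (\<lambda>_. 0) x y" "x 0 = 0"
        "y \<in> ell2" "y \<noteq> (\<lambda>_. 0)"
        unfolding point_spectrum_iff by blast
      hence "z \<notin> E" using elliptic by blast
      moreover have "y 0 \<noteq> 0" using J.orbit_zero[OF xy(1,2)] xy(4) by blast
      ultimately show "z \<in> E\<^sub>p"
        using hyp J.ell2_orbit_hyperbolic[OF xy(1,3,2)] unfolding Ep by blast
    next
      assume "z \<in> E\<^sub>p"
      hence "?y2 \<in> ell2" using J.decaying_orbit unfolding Ep by blast
      moreover have "?y2 \<noteq> (\<lambda>_. 0)"
        using J.orbit2(3) by (metis zero_neq_one)
      ultimately show "z \<in> ell2_point_spectrum H"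
        unfolding point_spectrum_iff using J.orbit2(1,2) by blast
    qed
    moreover have "z \<in> ell2_spectrum H \<longleftrightarrow> z \<in> E \<or> z \<in> E\<^sub>p"
    proof
      assume spec: "z \<in> ell2_spectrum H"
      show "z \<in> E \<or> z \<in> E\<^sub>p"
      proof (rule ccontr)
        assume no: "\<not> (z \<in> E \<or> z \<in> E\<^sub>p)"
        then obtain u v where uv: "u + v = ?x1 s + ?y2 s" "u * v = 1" "cmod u < 1"
          using hyp by blast
        obtain K where "\<And>g. g \<in> ell2 \<Longrightarrow> \<exists>x y. jacobi_orbit coupling (potential z) g x y \<and>
            x 0 = 0 \<and> y \<in> ell2 \<and> sqsum y \<le> K * sqsum g"
          using J.hyperbolic_solvable[OF uv] no unfolding Ep by blast
        from resolvent_set_if_solvable[OF this] have "z \<in> ell2_resolvent_set H"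
          using no point by blast
        thus False using spec by (simp add: ell2_spectrum_def)
      qed
    next
      \<comment> \<open>On \<open>E\<close> every square summable orbit is zero, so the first unit
        vector is not attained; points of \<open>E\<^sub>p\<close> are eigenvalues.\<close>
      assume "z \<in> E \<or> z \<in> E\<^sub>p"
      thus "z \<in> ell2_spectrum H"
        using point point_spectrum_subset spectrum_if_no_ell2_orbit elliptic by blast
    qed
    ultimately show ?thesis by blast
  qed
  thus ?thesis by blast
qed

end
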